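(* Let $\rho\in\mathbb{C}$ with $|\rho|<1$, let $x\in(0,\infty)$, and let $a,b,c,d,h$ be complex parameters with positive real parts, such that the non-real parameters occur in conjugate pairs among $a,b,c,d$ and also among $a,b,c,h$. Then $$ (1-\rho)^{1-a-b-c-d}\ {}_4F_3\!\left(\begin{matrix}\tfrac12(a+b+c+d-1),\ \tfrac12(a+b+c+d),\ a+ix,\ a-ix\\ a+b,\ a+c,\ a+d\end{matrix};-\frac{4\rho}{(1-\rho)^2}\right) $$ $$ =\sum_{k=0}^\infty \frac{(k+a+b+c+d-1)_k\,(a+b+c+d-1)_k}{(k+a+b+c+h-1)_k\,(a+b)_k\,(a+c)_k\,(a+d)_k\,k!} \ {}_3F_2\!\left(\begin{matrix}2k+a+b+c+d-1,\ d-h,\ k+b+c\\ 2k+a+b+c+h,\ a+d+k\end{matrix};\rho\right)\rho^k\,W_k(x^2;a,b,c,h). $$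
   Context: The Pochhammer symbol is $(z)_n=\prod_{i=1}^n(z+i-1)$ for $z\in\mathbb{C}$, $n\in\{0,1,2,\dots\}$ (so $(z)_0=1$). The generalized hypergeometric function is ${}_pF_q(a_1,\dots,a_p;b_1,\dots,b_q;z)=\sum_{n\ge0}\frac{(a_1)_n\cdots(a_p)_n}{(b_1)_n\cdots(b_q)_n}\frac{z^n}{n!}$; for $p=q+1$ the series converges for $|z|<1$ and the function is continued analytically to $\mathbb{C}\setminus[1,\infty)$. The map $\rho\mapsto-4\rho/(1-\rho)^2$ sends the unit disk bijectively onto $\mathbb{C}\setminus[1,\infty)$, so the left-hand side is well defined. Powers of $1-\rho$ are taken with the principal branch. The Wilson polynomials are $$W_n(x^2;a,b,c,d)=(a+b)_n(a+c)_n(a+d)_n\ {}_4F_3\!\left(\begin{matrix}-n,\ n+a+b+c+d-1,\ a+ix,\ a-ix\\ a+b,\ a+c,\ a+d\end{matrix};1\right).$$ *)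

theory Defs
  imports "HOL-Complex_Analysis.Complex_Analysis" "HOL-Library.Multiset"
begin

text \<open>
  The coefficients are those of the defining series of \<open>pFq\<close>; the value is meaningful only where
  the series converges and no denominator vanishes.
\<close>
definition hyp_series :: "complex list \<Rightarrow> complex list \<Rightarrow> complex \<Rightarrow> complex" where
  "hyp_series as bs z =
     (\<Sum>n. (\<Prod>a\<leftarrow>as. pochhammer a n) / (\<Prod>b\<leftarrow>bs. pochhammer b n) * (z ^ n / fact n))"

definition slit_plane :: "complex set" where
  "slit_plane = - (complex_of_real ` {1..})"

text \<open>
  Analytic continuation of \<open>pFq\<close> (for \<open>p = q + 1\<close>) from the open unit disk to the plane cut along
  \<open>[1,\<infinity>)\<close>. On \<open>slit_plane\<close> there is at most one candidate value, by the identity theorem; see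
  \<open>hyp_continued_eqI\<close> below.
\<close>
definition hyp_continued :: "complex list \<Rightarrow> complex list \<Rightarrow> complex \<Rightarrow> complex" where
  "hyp_continued as bs z =
     (THE w. \<exists>f. f holomorphic_on slit_plane \<and>
                 (\<forall>u\<in>ball 0 1. f u = hyp_series as bs u) \<and> w = f z)"

text \<open>
  \<open>wilson n x a b c d\<close> is \<open>W\<^sub>n(x\<^sup>2; a, b, c, d)\<close>: the argument is \<open>x\<close>, not \<open>x\<^sup>2\<close>.
  Because of the parameter \<open>-n\<close> the series terminates, so that the argument 1 is unproblematic.
\<close>
definition wilson :: "nat \<Rightarrow> complex \<Rightarrow> complex \<Rightarrow> complex \<Rightarrow> complex \<Rightarrow> complex \<Rightarrow> complex" where
  "wilson n x a b c d =
     pochhammer (a + b) n * pochhammer (a + c) n * pochhammer (a + d) n *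
     hyp_series [- of_nat n, of_nat n + a + b + c + d - 1, a + \<i> * x, a - \<i> * x]
                [a + b, a + c, a + d] 1"

text \<open>Multisets, because pairing must respect repeated parameters.\<close>
definition nonreal_in_conjugate_pairs :: "complex multiset \<Rightarrow> bool" where
  "nonreal_in_conjugate_pairs M \<longleftrightarrow> (\<forall>z. z \<notin> \<real> \<longrightarrow> count M (cnj z) = count M z)"

lemma open_slit_plane: "open slit_plane"
proof -
  have "complex_of_real ` {1..} = \<real> \<inter> {z. Re z \<ge> 1}"
    by (auto simp: complex_is_Real_iff complex_eq_iff image_iff)
  then show ?thesis
    unfolding slit_plane_def
    by (metis open_Compl closed_Int closed_complex_Reals closed_halfspace_Re_ge)
qed

lemma ball_subset_slit_plane: "ball 0 1 \<subseteq> slit_plane"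
  by (auto simp: slit_plane_def)

lemma starlike_slit_plane: "starlike slit_plane"
  unfolding starlike_def
proof (intro bexI[of _ 0] ballI subsetI)
  show "0 \<in> slit_plane"
    using ball_subset_slit_plane by auto
  fix z w :: complex
  assume z: "z \<in> slit_plane" and "w \<in> closed_segment 0 z"
  then obtain u where u: "0 \<le> u" "u \<le> 1" "w = u *\<^sub>R z"
    by (auto simp: in_segment)
  show "w \<in> slit_plane"
  proof (rule ccontr)
    assume "w \<notin> slit_plane"
    then obtain t where t: "t \<ge> 1" "w = complex_of_real t"
      by (auto simp: slit_plane_def)
    with u have "u > 0"
      by (cases "u = 0") auto
    with u t have "z = complex_of_real (t / u)" "t / u \<ge> 1"
      by (auto simp: field_simps scaleR_conv_of_real)
    with z show False
      unfolding slit_plane_def by blast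
  qed
qed

lemma hyp_continued_eqI:
  assumes f: "f holomorphic_on slit_plane"
    and f_eq: "\<And>u. u \<in> ball 0 1 \<Longrightarrow> f u = hyp_series as bs u"
    and z: "z \<in> slit_plane"
  shows "hyp_continued as bs z = f z"
  unfolding hyp_continued_def
proof (rule the_equality)
  show "\<exists>g. g holomorphic_on slit_plane \<and> (\<forall>u\<in>ball 0 1. g u = hyp_series as bs u) \<and> f z = g z"
    using f f_eq by blast
next
  fix w
  assume "\<exists>g. g holomorphic_on slit_plane \<and> (\<forall>u\<in>ball 0 1. g u = hyp_series as bs u) \<and> w = g z"
  then obtain g where g: "g holomorphic_on slit_plane"
      "\<And>u. u \<in> ball 0 1 \<Longrightarrow> g u = hyp_series as bs u" "w = g z"
    by blast
  have "g z = f z"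
  proof (rule analytic_continuation_open[where s = "ball 0 1" and s' = slit_plane and f = g and g = f])
    show "connected slit_plane"
      by (rule starlike_imp_connected[OF starlike_slit_plane])
  next
    fix u :: complex
    assume "u \<in> ball 0 1"
    then show "g u = f u"
      using f_eq g by simp
  next
  qed (use f g z open_slit_plane ball_subset_slit_plane in auto)
  with g show "w = f z"
    by simp
qed

end

theory Submission
  imports Defs
begin

text \<open>
  Write \<open>s = a + b + c + d\<close> and let \<open>p\<^sub>n(d)\<close> be the terminating \<open>4F3\<close> in \<open>W\<^sub>n(x\<^sup>2; a, b, c, d)\<close>.
  Expanding the powers of \<open>1 - \<rho>\<close> shows that, for small \<open>\<rho>\<close>, the left-hand side is
  \<open>\<Sum>n. (s - 1)\<^sub>n / n! p\<^sub>n(d) \<rho>\<^sup>n\<close>. The three-term recurrence of the Wilson polynomials bounds the growth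
  of \<open>p\<^sub>n\<close> subexponentially, so this power series is holomorphic on the unit disk; transported
  along the inverse of \<open>\<rho> \<mapsto> -4\<rho>/(1 - \<rho>)\<^sup>2\<close> it is itself the analytic continuation of the \<open>4F3\<close>, and the
  identity extends to the whole disk. The right-hand side is a double series, absolutely convergent by the
  same growth bounds. Rearranged by powers of \<open>\<rho>\<close>, it reduces the claim to the
  connection formula from \<open>p\<^sub>k(h)\<close> to \<open>p\<^sub>n(d)\<close>, whose coefficients in the basis
  \<open>(a + ix)\<^sub>j (a - ix)\<^sub>j\<close> are terminating very-well-poised \<open>5F4\<close> sums.
\<close>

section \<open>The terminating very-well-poised sum\<close>

lemma pochhammer_nz:
  fixes z :: complex
  assumes "Re z > 0"
  shows "pochhammer z n \<noteq> 0"
proof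
  assume "pochhammer z n = 0"
  then obtain k where "z = - of_nat k"
    by (auto simp: pochhammer_eq_0_iff)
  then show False
    using assms by simp
qed

text \<open>What remains of the WZ equation for the summand once all common factors are divided out,
  with \<open>N = i + m\<close>. The letters \<open>b\<close> and \<open>b'\<close> stand for
  \<open>N choose i\<close> and \<open>N choose (i - 1)\<close>; the hypothesis is the absorption
  identity between them.\<close>

lemma well_poised_5F4_step:
  fixes A C e b b' i m :: complex
  assumes "b' * (m + 1) = b * i"
  shows "(b + b') * (A + e + (i + m) + i) * (e + m) * (A + 1 - C + i + m) * (A + 2 * i)
          - (C + e + (i + m)) * b * (A + e + (i + m)) * (A + 2 * i) * (A + i + (i + m) + 1)
       = - b * (A + 1 + e + 2 * (i + m)) * (A + e + (i + m) + i) * (C + i) * (A + i)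
          + b' * (A + 1 + e + 2 * (i + m)) * (e + m) * (A - C + i) * (A + i + (i + m) + 1)"
  using assms by algebra

text \<open>
  The well-poised factor \<open>(A + 2i) / (A)\<^bsub>N+i+1\<^esub> * (A)\<^sub>i\<close> is written as
  \<open>1 / ((A + i)\<^sub>i (A + 2i + 1)\<^bsub>N-i\<^esub>)\<close>, so that \<open>A = 0\<close> is not degenerate.
\<close>
lemma well_poised_5F4_sum:
  fixes A C e :: complex
  assumes A: "Re A > -1"
  shows "(\<Sum>i\<le>N. of_nat (N choose i) * pochhammer (A + e + of_nat N) i * pochhammer C i *
            pochhammer e (N - i) * pochhammer (A + 1 - C + of_nat i) (N - i) /
            (pochhammer (A + of_nat i) i * pochhammer (A + 2 * of_nat i + 1) (N - i)))
         = pochhammer (C + e) N"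
proof -
  define t where "t N i = of_nat (N choose i) * pochhammer (A + e + of_nat N) i * pochhammer C i *
            pochhammer e (N - i) * pochhammer (A + 1 - C + of_nat i) (N - i) /
            (pochhammer (A + of_nat i) i * pochhammer (A + 2 * of_nat i + 1) (N - i))" for N i
  \<comment> \<open>WZ pair: \<open>t (N + 1) i - (C + e + N) t N i\<close> telescopes with certificate \<open>G N\<close>.\<close>
  define G where "G N i = (case i of 0 \<Rightarrow> 0 | Suc l \<Rightarrow>
      - (of_nat (N choose l) * (A + 1 + e + 2 * of_nat N) * pochhammer (A + e + of_nat N + 1) l *
         pochhammer C (Suc l) * pochhammer e (N - l) * pochhammer (A + 1 - C + of_nat l) (N - l) /
         pochhammer (A + 1 + of_nat l) (Suc N)))" for N i
  have nz: "A + of_nat k \<noteq> 0" if "k > 0" for k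
  proof
    assume "A + of_nat k = 0"
    then have "Re (A + of_nat k) = 0" by simp
    with A that show False by simp
  qed
  have pnz: "pochhammer (A + of_nat k) n \<noteq> 0" if "k > 0" for k n
    by (rule pochhammer_nz) (use A that in simp)
  \<comment> \<open>Merging both denominators into one Pochhammer symbol brings out the
    very-well-poised factor \<open>A + 2i\<close>. At \<open>i = 0\<close> this factor is
    \<open>A\<close>, which may vanish, so that case is excluded.\<close>
  have den: "1 / (pochhammer (A + of_nat i) i * pochhammer (A + 2 * of_nat i + 1) (N - i)) =
     (A + 2 * of_nat i) / pochhammer (A + of_nat i) (Suc N)" if "i > 0" "i \<le> N" for i N
  proof -
    have "pochhammer (A + of_nat i) (Suc N) =
        pochhammer (A + of_nat i) i * pochhammer (A + of_nat i + of_nat i) (Suc N - i)"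
      using that by (intro pochhammer_product) simp
    also have "pochhammer (A + of_nat i + of_nat i) (Suc N - i) =
       (A + 2 * of_nat i) * pochhammer (A + 2 * of_nat i + 1) (N - i)"
      using that by (simp add: Suc_diff_le pochhammer_rec algebra_simps)
    finally show ?thesis
      using nz[of "2 * i"] that by simp
  qed
  have step: "t (Suc N) i - (C + e + of_nat N) * t N i = G N (Suc i) - G N i" if "i \<le> Suc N" for N i
  proof -
    consider "i = 0" | "i = Suc N" | l m where "i = Suc l" "N = i + m"
    proof (cases i)
      case 0
      then show ?thesis using that by blast
    next
      case (Suc l)
      show ?thesis
      proof (cases "i \<le> N")
        case True
        then show ?thesis
          using Suc that(3)[of l "N - i"] by simp
      next
        case False
        then show ?thesis
          using \<open>i \<le> Suc N\<close> that(2) by simp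
      qed
    qed
    then show ?thesis
    proof cases
      case 1
      define E where "E = pochhammer e N"
      define Z where "Z = pochhammer (A + 1 - C) N"
      define D where "D = pochhammer (A + 1) N"
      have nz0: "A + 1 + of_nat N \<noteq> 0" "D \<noteq> 0"
        using nz[of "Suc N"] pnz[of 1] by (simp_all add: D_def algebra_simps)
      have "t (Suc N) i = E * (e + of_nat N) * (Z * (A + 1 - C + of_nat N)) / (D * (A + 1 + of_nat N))"
        using 1 by (simp add: t_def E_def Z_def D_def pochhammer_Suc)
      moreover have "t N i = E * Z / D"
        using 1 by (simp add: t_def E_def Z_def D_def)
      moreover have "G N (Suc i) = - ((A + 1 + e + 2 * of_nat N) * C * E * Z / (D * (A + 1 + of_nat N)))" "G N i = 0"
        using 1 by (simp_all add: G_def E_def Z_def D_def pochhammer_Suc)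
      ultimately show ?thesis
        using nz0 by (simp add: divide_simps) algebra
    next
      case 2
      then show ?thesis
        by (simp add: t_def G_def binomial_eq_0 pochhammer_Suc ac_simps)
    next
      case (3 l m)
      define Q where "Q = pochhammer (A + e + of_nat N + 1) l"
      define P where "P = pochhammer C i"
      define E where "E = pochhammer e m"
      define Z where "Z = pochhammer (A + 1 - C + of_nat i) m"
      \<comment> \<open>\<open>D\<close> is the common denominator of the four terms: each of their
        own denominators is \<open>D\<close>, possibly without its first or its last factor.\<close>
      define D where "D = pochhammer (A + of_nat i) (Suc (Suc N))"
      define b :: complex where "b = of_nat (N choose i)"
      define b' :: complex where "b' = of_nat (N choose l)"
      have D: "D \<noteq> 0" unfolding D_def by (rule pnz) (use 3 in simp)
      have D1: "D = (A + of_nat i) * pochhammer (A + 1 + of_nat i) (Suc N)"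
        unfolding D_def by (subst pochhammer_rec) (simp add: algebra_simps)
      have D2: "D = pochhammer (A + of_nat i) (Suc N) * (A + of_nat i + of_nat N + 1)"
        unfolding D_def by (subst pochhammer_Suc) (simp add: algebra_simps)
      have h1: "1 / pochhammer (A + 1 + of_nat i) (Suc N) = (A + of_nat i) / D"
        using D D1 by (simp add: divide_simps)
      have h2: "1 / pochhammer (A + of_nat i) (Suc N) = (A + of_nat i + of_nat N + 1) / D"
        using D D2 by (simp add: divide_simps)
      have q1: "pochhammer (A + e + of_nat (Suc N)) i = Q * (A + e + of_nat N + of_nat i)"
        unfolding Q_def \<open>i = Suc l\<close> pochhammer_Suc by (simp add: algebra_simps)
      have q2: "pochhammer (A + e + of_nat N) i = (A + e + of_nat N) * Q"
        unfolding Q_def \<open>i = Suc l\<close> pochhammer_rec by (simp add: algebra_simps)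
      have q3: "pochhammer (A + e + of_nat N + 1) i = Q * (A + e + of_nat N + of_nat i)"
        unfolding Q_def \<open>i = Suc l\<close> pochhammer_Suc by (simp add: algebra_simps)
      have z1: "pochhammer (A + 1 - C + of_nat i) (Suc m) = Z * (A + 1 - C + of_nat i + of_nat m)"
        unfolding Z_def pochhammer_Suc by simp
      have z2: "pochhammer (A + 1 - C + of_nat l) (Suc m) = (A - C + of_nat i) * Z"
        unfolding Z_def pochhammer_rec \<open>i = Suc l\<close> by (simp add: algebra_simps)
      have bb: "b' * (of_nat m + 1) = b * of_nat i"
      proof -
        have "Suc l * (N choose Suc l) = (N - l) * (N choose l)"
          by (metis binomial_absorb_comp binomial_absorption mult.commute)
        also have "N - l = Suc m" using 3 by simp
        finally have "of_nat (Suc l * (N choose Suc l)) = (of_nat (Suc m * (N choose l)) :: complex)"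
          by simp
        then show ?thesis
          unfolding b_def b'_def \<open>i = Suc l\<close> by (simp add: algebra_simps)
      qed
      have B: "of_nat (Suc N choose i) = b + b'"
        unfolding b_def b'_def \<open>i = Suc l\<close> by simp
      have m: "Suc N - i = Suc m" "N - i = m" "N - l = Suc m"
        using 3 by simp_all
      have t1: "t (Suc N) i = (b + b') * (Q * (A + e + of_nat N + of_nat i)) * P * (E * (e + of_nat m)) *
           (Z * (A + 1 - C + of_nat i + of_nat m)) * ((A + 2 * of_nat i) / D)"
      proof -
        have "t (Suc N) i = of_nat (Suc N choose i) * pochhammer (A + e + of_nat (Suc N)) i * P *
            pochhammer e (Suc m) * pochhammer (A + 1 - C + of_nat i) (Suc m) *
            (1 / (pochhammer (A + of_nat i) i * pochhammer (A + 2 * of_nat i + 1) (Suc N - i)))"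
          unfolding t_def P_def m by simp
        also have "(1 / (pochhammer (A + of_nat i) i * pochhammer (A + 2 * of_nat i + 1) (Suc N - i)))
            = (A + 2 * of_nat i) / D"
          unfolding D_def by (rule den) (use 3 in auto)
        finally show ?thesis
          unfolding B q1 z1 E_def pochhammer_Suc[of e] by simp
      qed
      have t0: "t N i = b * ((A + e + of_nat N) * Q) * P * E * Z *
           ((A + 2 * of_nat i) * (A + of_nat i + of_nat N + 1) / D)"
      proof -
        have "t N i = b * pochhammer (A + e + of_nat N) i * P * E * Z *
            (1 / (pochhammer (A + of_nat i) i * pochhammer (A + 2 * of_nat i + 1) (N - i)))"
          unfolding t_def P_def m E_def Z_def b_def by simp
        also have "(1 / (pochhammer (A + of_nat i) i * pochhammer (A + 2 * of_nat i + 1) (N - i)))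
            = (A + 2 * of_nat i) * (1 / pochhammer (A + of_nat i) (Suc N))"
          by (subst den) (use 3 in auto)
        finally show ?thesis
          unfolding q2 h2 by simp
      qed
      have g1: "G N (Suc i) = - (b * (A + 1 + e + 2 * of_nat N) * (Q * (A + e + of_nat N + of_nat i)) *
          (P * (C + of_nat i)) * E * Z * ((A + of_nat i) / D))"
      proof -
        have "G N (Suc i) = - (b * (A + 1 + e + 2 * of_nat N) * pochhammer (A + e + of_nat N + 1) i *
          pochhammer C (Suc i) * E * Z * (1 / pochhammer (A + 1 + of_nat i) (Suc N)))"
          unfolding G_def b_def E_def Z_def using m by simp
        then show ?thesis
          unfolding h1 q3 pochhammer_Suc[of C] P_def .
      qed
      have g0: "G N i = - (b' * (A + 1 + e + 2 * of_nat N) * Q * P * (E * (e + of_nat m)) *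
          ((A - C + of_nat i) * Z) * ((A + of_nat i + of_nat N + 1) / D))"
      proof -
        have "G N i = - (b' * (A + 1 + e + 2 * of_nat N) * Q * P * pochhammer e (Suc m) *
          pochhammer (A + 1 - C + of_nat l) (Suc m) * (1 / pochhammer (A + 1 + of_nat l) (Suc N)))"
          unfolding G_def b'_def Q_def P_def using m \<open>i = Suc l\<close> by simp
        also have "A + 1 + of_nat l = A + of_nat i"
          using \<open>i = Suc l\<close> by simp
        finally show ?thesis
          unfolding h2 z2 pochhammer_Suc[of e] E_def .
      qed
      have N: "of_nat N = of_nat i + (of_nat m :: complex)"
        using 3 by simp
      define K where "K = Q * P * E * Z / D"
      have "t (Suc N) i - (C + e + of_nat N) * t N i = K *
         ((b + b') * (A + e + (of_nat i + of_nat m) + of_nat i) * (e + of_nat m) * (A + 1 - C + of_nat i + of_nat m) * (A + 2 * of_nat i)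
          - (C + e + (of_nat i + of_nat m)) * b * (A + e + (of_nat i + of_nat m)) * (A + 2 * of_nat i) * (A + of_nat i + (of_nat i + of_nat m) + 1))"
        unfolding t0 t1 N K_def divide_inverse by algebra
      also have "\<dots> = K * (- b * (A + 1 + e + 2 * (of_nat i + of_nat m)) * (A + e + (of_nat i + of_nat m) + of_nat i) * (C + of_nat i) * (A + of_nat i)
          + b' * (A + 1 + e + 2 * (of_nat i + of_nat m)) * (e + of_nat m) * (A - C + of_nat i) * (A + of_nat i + (of_nat i + of_nat m) + 1))"
        using well_poised_5F4_step[OF bb, of A e C] by simp
      also have "\<dots> = G N (Suc i) - G N i"
        unfolding g0 g1 N K_def divide_inverse by algebra
      finally show ?thesis .
    qed
  qed
  have "(\<Sum>i\<le>N. t N i) = pochhammer (C + e) N"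
  proof (induction N)
    case 0
    then show ?case by (simp add: t_def)
  next
    case (Suc N)
    have "(\<Sum>i\<le>Suc N. t (Suc N) i) - (C + e + of_nat N) * (\<Sum>i\<le>Suc N. t N i) =
        (\<Sum>i\<le>Suc N. G N (Suc i) - G N i)"
      unfolding sum_distrib_left sum_subtractf[symmetric] by (intro sum.cong) (auto simp: step)
    also have "\<dots> = G N (Suc (Suc N)) - G N 0"
      using sum_lessThan_telescope[of "G N" "Suc (Suc N)"] by (simp add: lessThan_Suc_atMost)
    \<comment> \<open>\<open>G N\<close> vanishes at 0 by its case distinction and at
      \<open>N + 2\<close> because \<open>N choose (N + 1)\<close> is 0. The same binomial
      coefficient removes the extra term \<open>t N (Suc N)\<close> below.\<close>
    also have "\<dots> = 0"
      by (simp add: G_def)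
    also have "(\<Sum>i\<le>Suc N. t N i) = (\<Sum>i\<le>N. t N i)"
      by (simp add: t_def)
    finally show ?case
      using Suc by (simp add: pochhammer_Suc)
  qed
  then show ?thesis
    unfolding t_def .
qed

section \<open>Sequences of subexponential growth\<close>

text \<open>Equivalently, the limit superior of the n-th roots of the norms is at most 1, which is
  the growth that makes a power series converge in the whole open unit disk. The class is stable
  under products, so growth estimates can be made factor by factor.\<close>

definition subexp :: "(nat \<Rightarrow> 'a :: real_normed_field) \<Rightarrow> bool" where
  "subexp f \<longleftrightarrow> (\<forall>q>1. \<exists>K. \<forall>n. norm (f n) \<le> K * q ^ n)"

lemma subexpE:
  assumes "subexp f" "q > 1"
  obtains K where "K \<ge> 0" "\<And>n. norm (f n) \<le> K * q ^ n"
proof -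
  obtain K where K: "\<And>n. norm (f n) \<le> K * q ^ n"
    using assms unfolding subexp_def by blast
  have "K \<ge> 0"
    using order_trans[OF norm_ge_zero K[of 0]] by simp
  with K that show thesis by blast
qed

lemma subexp_mult:
  assumes "subexp f" "subexp g"
  shows "subexp (\<lambda>n. f n * g n)"
  unfolding subexp_def
proof (intro allI impI)
  fix q :: real
  assume q: "q > 1"
  then have "sqrt q > 1" by simp
  obtain K where K: "K \<ge> 0" "\<And>n. norm (f n) \<le> K * sqrt q ^ n"
    using subexpE[OF assms(1) \<open>sqrt q > 1\<close>] by blast
  obtain L where L: "L \<ge> 0" "\<And>n. norm (g n) \<le> L * sqrt q ^ n"
    using subexpE[OF assms(2) \<open>sqrt q > 1\<close>] by blast
  have "norm (f n * g n) \<le> K * L * q ^ n" for n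
  proof -
    have "norm (f n * g n) \<le> (K * sqrt q ^ n) * (L * sqrt q ^ n)"
      unfolding norm_mult using K L q by (intro mult_mono) auto
    also have "\<dots> = K * L * (sqrt q * sqrt q) ^ n"
      unfolding power_mult_distrib by simp
    finally show ?thesis using q by simp
  qed
  then show "\<exists>K. \<forall>n. norm (f n * g n) \<le> K * q ^ n" by blast
qed

text \<open>The majorant \<open>E\<close> is free, so that it may combine several consecutive terms
  of \<open>f\<close>, as a second-order recurrence demands. The finitely many terms before the
  estimate sets in are absorbed by the constant.\<close>

lemma subexpI:
  assumes "\<And>q. q > 1 \<Longrightarrow> \<exists>E. \<forall>\<^sub>F n in sequentially. norm (f n) \<le> E n \<and> E (Suc n) \<le> q * E n"
  shows "subexp f"
  unfolding subexp_def
proof (intro allI impI)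
  fix q :: real
  assume q: "q > 1"
  obtain E N where E: "\<And>n. n \<ge> N \<Longrightarrow> norm (f n) \<le> E n" "\<And>n. n \<ge> N \<Longrightarrow> E (Suc n) \<le> q * E n"
    using assms[OF q] unfolding eventually_sequentially by blast
  have E0: "E N \<ge> 0"
    using E(1)[of N] norm_ge_zero[of "f N"] by linarith
  have E': "E (N + n) \<le> E N * q ^ n" for n
  proof (induction n)
    case (Suc n)
    have "E (N + Suc n) \<le> q * E (N + n)" using E(2)[of "N + n"] by simp
    also have "\<dots> \<le> q * (E N * q ^ n)" using Suc q by simp
    finally show ?case by (simp add: ac_simps)
  qed simp
  have "norm (f n) \<le> ((\<Sum>i<N. norm (f i)) + E N) * q ^ n" for n
  proof (cases "n < N")
    case True
    have "norm (f n) \<le> (\<Sum>i<N. norm (f i))"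
      using True by (intro member_le_sum) auto
    also have "\<dots> \<le> (\<Sum>i<N. norm (f i)) + E N" using E0 by simp
    finally have le: "norm (f n) \<le> (\<Sum>i<N. norm (f i)) + E N" .
    have "1 \<le> q ^ n" using q by simp
    from mult_mono[OF le this] show ?thesis
      using E0 by (simp add: sum_nonneg)
  next
    case False
    then have "norm (f n) \<le> E N * q ^ (n - N)"
      using E(1)[of n] E'[of "n - N"] by simp
    also have "\<dots> \<le> E N * q ^ n"
      using E0 q by (intro mult_left_mono power_increasing) auto
    also have "\<dots> \<le> ((\<Sum>i<N. norm (f i)) + E N) * q ^ n"
      using q by (intro mult_right_mono) (auto intro: sum_nonneg)
    finally show ?thesis .
  qed
  then show "\<exists>K. \<forall>n. norm (f n) \<le> K * q ^ n" by blast
qed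

lemma subexp_summable:
  fixes r :: real
  assumes "subexp f" "0 \<le> r" "r < 1"
  shows "summable (\<lambda>n. norm (f n) * r ^ n)"
proof -
  \<comment> \<open>Any rate strictly between 1 and \<open>1 / r\<close> would do; this choice also
    covers \<open>r = 0\<close>.\<close>
  define q where "q = 2 / (1 + r)"
  have q: "q > 1" "q * r < 1" "0 \<le> q * r"
    using assms by (auto simp: q_def field_simps)
  obtain K where K: "K \<ge> 0" "\<And>n. norm (f n) \<le> K * q ^ n"
    using subexpE[OF assms(1) q(1)] by blast
  show ?thesis
  proof (rule summable_comparison_test')
    show "summable (\<lambda>n. K * (q * r) ^ n)"
      using q by (intro summable_mult summable_geometric) auto
    fix n :: nat
    show "norm (norm (f n) * r ^ n) \<le> K * (q * r) ^ n"
      using mult_right_mono[OF K(2)[of n], of "r ^ n"] assms by (simp add: power_mult_distrib)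
  qed
qed

lemma tendsto_shift_ratio:
  fixes p q :: "'a :: real_normed_field"
  shows "(\<lambda>n. (p + of_nat n) / (q + of_nat n)) \<longlonglongrightarrow> 1"
proof -
  have inf: "filterlim (\<lambda>n. q + of_nat n) at_infinity sequentially"
    by (rule tendsto_add_filterlim_at_infinity[OF tendsto_const tendsto_of_nat])
  have "(\<lambda>n. 1 + (p - q) / (q + of_nat n)) \<longlonglongrightarrow> 1 + 0"
    by (intro tendsto_add tendsto_const tendsto_divide_0[OF tendsto_const inf])
  moreover have "\<forall>\<^sub>F n in sequentially. q + of_nat n \<noteq> 0"
    using filterlim_at_infinity_imp_eventually_ne[OF inf, of 0] by simp
  then have "\<forall>\<^sub>F n in sequentially. 1 + (p - q) / (q + of_nat n) = (p + of_nat n) / (q + of_nat n)"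
    by eventually_elim (simp add: field_simps)
  ultimately show ?thesis
    by (simp add: tendsto_cong)
qed

text \<open>The quotient of consecutive terms tends to 1. If \<open>q\<close> is a nonpositive
  integer, division by zero makes the terms eventually 0, and the estimate persists.\<close>

lemma subexp_pochhammer_ratio:
  fixes p q :: "'a :: real_normed_field"
  shows "subexp (\<lambda>n. pochhammer p n / pochhammer q n)"
proof (rule subexpI)
  fix u :: real
  assume u: "u > 1"
  have "(\<lambda>n. norm ((p + of_nat n) / (q + of_nat n))) \<longlonglongrightarrow> norm (1 :: 'a)"
    by (intro tendsto_norm tendsto_shift_ratio)
  then have ev: "\<forall>\<^sub>F n in sequentially. norm ((p + of_nat n) / (q + of_nat n)) < u"
    using u by (intro order_tendstoD) auto
  show "\<exists>E. \<forall>\<^sub>F n in sequentially. norm (pochhammer p n / pochhammer q n) \<le> E n \<and> E (Suc n) \<le> u * E n"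
  proof (intro exI)
    show "\<forall>\<^sub>F n in sequentially. norm (pochhammer p n / pochhammer q n) \<le> norm (pochhammer p n / pochhammer q n)
      \<and> norm (pochhammer p (Suc n) / pochhammer q (Suc n)) \<le> u * norm (pochhammer p n / pochhammer q n)"
      using ev
    proof eventually_elim
      case (elim n)
      have "pochhammer p (Suc n) / pochhammer q (Suc n) =
          (p + of_nat n) / (q + of_nat n) * (pochhammer p n / pochhammer q n)"
        by (simp add: pochhammer_Suc mult.commute)
      with mult_right_mono[OF less_imp_le[OF elim], of "norm (pochhammer p n / pochhammer q n)"]
      show ?case
        by (simp only: norm_mult order_refl norm_ge_zero)
    qed
  qed
qed

lemma subexp_pochhammer_fact:
  "subexp (\<lambda>n. pochhammer p n / fact n :: 'a :: real_normed_field)"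
  unfolding pochhammer_fact by (rule subexp_pochhammer_ratio)

text \<open>Each factor is \<open>1 + p / (w + n)\<close>, of norm at most
  \<open>1 + norm p / (\<delta> + n)\<close>. The bound depends on \<open>w\<close> only through
  \<open>\<delta>\<close>, which makes it usable for bases that move with the summation
  index.\<close>

lemma norm_pochhammer_ratio_le:
  fixes w p :: complex
  assumes "0 < \<delta>" "\<delta> \<le> Re w"
  shows "norm (pochhammer (w + p) n / pochhammer w n) \<le> pochhammer (\<delta> + norm p) n / pochhammer \<delta> n"
proof (induction n)
  case (Suc n)
  have re: "\<delta> + real n \<le> norm (w + of_nat n)"
    using complex_Re_le_cmod[of "w + of_nat n"] assms by simp
  have "norm ((w + p + of_nat n) / (w + of_nat n)) \<le> (norm (w + of_nat n) + norm p) / norm (w + of_nat n)"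
    using norm_triangle_ineq[of "w + of_nat n" p]
    by (simp add: norm_divide divide_right_mono algebra_simps)
  also have "\<dots> = 1 + norm p / norm (w + of_nat n)"
  proof -
    have "norm (w + of_nat n) \<noteq> 0"
      using re assms by linarith
    then show ?thesis
      by (simp add: add_divide_distrib)
  qed
  also have "\<dots> \<le> 1 + norm p / (\<delta> + real n)"
    using re assms by (intro add_left_mono divide_left_mono mult_pos_pos) auto
  also have "\<dots> = (\<delta> + norm p + real n) / (\<delta> + real n)"
    using assms by (simp add: field_simps)
  finally have step: "norm ((w + p + of_nat n) / (w + of_nat n)) \<le> (\<delta> + norm p + real n) / (\<delta> + real n)" .
  have "norm (pochhammer (w + p) (Suc n) / pochhammer w (Suc n)) =
     norm (pochhammer (w + p) n / pochhammer w n) * norm ((w + p + of_nat n) / (w + of_nat n))"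
    unfolding norm_mult[symmetric] by (simp add: pochhammer_Suc)
  also have "\<dots> \<le> pochhammer (\<delta> + norm p) n / pochhammer \<delta> n * ((\<delta> + norm p + real n) / (\<delta> + real n))"
    using assms by (intro mult_mono Suc step) (auto intro!: divide_nonneg_nonneg pochhammer_nonneg add_pos_nonneg)
  finally show ?case
    by (simp add: pochhammer_Suc)
qed simp

section \<open>Rearrangement of double series, and binomial series\<close>

text \<open>Both series are iterated sums of one absolutely summable family over pairs; the
  bijection from \<open>(k, m)\<close> to \<open>(k + m, k)\<close> turns rows into diagonals. The
  sequence \<open>B\<close> allows row norms to be estimated instead of computed.\<close>

lemma sums_triangle:
  fixes F :: "nat \<Rightarrow> nat \<Rightarrow> complex"
  assumes F: "\<And>k. summable (\<lambda>m. norm (F k m))"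
    and B: "\<And>k. (\<Sum>m. norm (F k m)) \<le> B k" "summable B"
  obtains S where "(\<lambda>k. \<Sum>m. F k m) sums S" "(\<lambda>n. \<Sum>k\<le>n. F k (n - k)) sums S"
proof -
  have row: "(F k has_sum (\<Sum>m. F k m)) UNIV" for k
    by (rule norm_summable_imp_has_sum[OF F]) (use F summable_norm_cancel summable_sums in blast)
  have nrow: "infsum (\<lambda>m. norm (F k m)) UNIV = (\<Sum>m. norm (F k m))" for k
    by (intro infsumI norm_summable_imp_has_sum) (use F in \<open>auto intro: summable_sums\<close>)
  have "summable (\<lambda>k. norm (\<Sum>m. norm (F k m)))"
  proof (rule summable_comparison_test'[OF B(2)])
    show "norm (norm (\<Sum>m. norm (F k m))) \<le> B k" for k
      using B(1)[of k] suminf_nonneg[OF F[of k]] by simp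
  qed
  then have "(\<lambda>x. norm (case x of (k, m) \<Rightarrow> F k m)) summable_on (UNIV \<times> UNIV)"
    unfolding Infinite_Sum.abs_summable_on_Sigma_iff
    by (auto intro!: norm_summable_imp_summable_on simp: nrow F)
  then obtain S where S: "((\<lambda>(k, m). F k m) has_sum S) (UNIV \<times> UNIV)"
    using Infinite_Sum.abs_summable_summable summable_on_def by blast
  have "((\<lambda>k. \<Sum>m. F k m) has_sum S) UNIV"
    by (rule has_sum_SigmaD[OF S]) (use row in auto)
  moreover have "((\<lambda>(n, k). F k (n - k)) has_sum S) (SIGMA n:UNIV. {..n}) \<longleftrightarrow>
      ((\<lambda>(k, m). F k m) has_sum S) (UNIV \<times> UNIV)"
    by (rule has_sum_reindex_bij_witness[where i = "\<lambda>(k, m). (k + m, k)" and j = "\<lambda>(n, k). (k, n - k)"]) auto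
  then have S': "((\<lambda>(n, k). F k (n - k)) has_sum S) (SIGMA n:UNIV. {..n})"
    using S by blast
  have "((\<lambda>n. \<Sum>k\<le>n. F k (n - k)) has_sum S) UNIV"
    by (rule has_sum_SigmaD[OF S']) (simp add: has_sum_finite)
  ultimately show thesis
    by (intro that has_sum_imp_sums)
qed

lemma neg_binomial_complex:
  fixes z w :: complex
  assumes "norm z < 1"
  shows "(\<lambda>n. pochhammer w n / fact n * z ^ n) sums ((1 - z) powr (- w))"
proof -
  have "(\<lambda>n. (- w gchoose n) * (- z) ^ n) sums (1 + (- z)) powr (- w)"
    by (rule gen_binomial_complex) (use assms in simp)
  moreover have "(- w gchoose n) * (- z) ^ n = pochhammer w n / fact n * z ^ n" for n
    unfolding gbinomial_pochhammer power_minus[of z] by simp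
  ultimately show ?thesis by simp
qed

text \<open>Sums the majorants that arise when the terms of the complex series are replaced by
  norms.\<close>

lemma neg_binomial_real:
  fixes r w :: real
  assumes "0 \<le> r" "r < 1"
  shows "(\<lambda>n. pochhammer w n / fact n * r ^ n) sums ((1 - r) powr (- w))"
proof -
  have "(\<lambda>n. (- w gchoose n) * (- r) ^ n) sums (1 + (- r)) powr (- w)"
    by (rule gen_binomial_real) (use assms in simp)
  moreover have "(- w gchoose n) * (- r) ^ n = pochhammer w n / fact n * r ^ n" for n
    unfolding gbinomial_pochhammer power_minus[of r] by simp
  ultimately show ?thesis by simp
qed

lemma norm_pochhammer_le:
  fixes w :: complex
  assumes "norm w \<le> v"
  shows "norm (pochhammer w n) \<le> pochhammer v n"
proof (induction n)
  case (Suc n)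
  have "norm (w + of_nat n) \<le> v + real n"
    using norm_triangle_ineq[of w "of_nat n"] assms by simp
  moreover have "0 \<le> pochhammer v n"
    using Suc norm_ge_zero order_trans by blast
  ultimately show ?case
    unfolding pochhammer_Suc norm_mult by (intro mult_mono Suc) auto
qed simp

lemma subexp_norm: "subexp f \<Longrightarrow> subexp (\<lambda>n. norm (f n))"
  by (simp add: subexp_def)

lemma subexp_mono:
  assumes "subexp g" "\<And>n. norm (f n) \<le> norm (g n)"
  shows "subexp f"
  unfolding subexp_def
proof (intro allI impI)
  fix q :: real
  assume "q > 1"
  then obtain K where "\<And>n. norm (g n) \<le> K * q ^ n"
    using assms(1) unfolding subexp_def by blast
  then have "norm (f n) \<le> K * q ^ n" for n
    by (rule order_trans[OF assms(2)])
  then show "\<exists>K. \<forall>n. norm (f n) \<le> K * q ^ n" by blast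
qed

lemma subexp_summable_complex:
  fixes u :: "nat \<Rightarrow> complex"
  assumes "subexp u" "norm z < 1"
  shows "summable (\<lambda>n. u n * z ^ n)"
proof (rule summable_norm_cancel)
  show "summable (\<lambda>n. norm (u n * z ^ n))"
    using subexp_summable[OF assms(1) norm_ge_zero assms(2)] by (simp add: norm_mult norm_power)
qed

lemma subexp_holomorphic:
  fixes u :: "nat \<Rightarrow> complex"
  assumes "subexp u"
  shows "(\<lambda>z. \<Sum>n. u n * z ^ n) holomorphic_on ball 0 1"
proof (rule power_series_holomorphic)
  fix z :: complex
  assume "z \<in> ball 0 1"
  then have "norm z < 1" by simp
  then show "(\<lambda>n. u n * (z - 0) ^ n) sums (\<Sum>n. u n * z ^ n)"
    using summable_sums[OF subexp_summable_complex[OF assms]] by simp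
qed

text \<open>Three upper parameters are paired with the lower ones and the fourth with
  \<open>fact n\<close>, so the coefficients are products of subexponential quotients.\<close>

lemma hyp_series_4F3_holomorphic:
  "hyp_series [p1, p2, p3, p4] [q1, q2, q3] holomorphic_on ball 0 1"
proof -
  have "subexp (\<lambda>n. (pochhammer p1 n / pochhammer q1 n) * (pochhammer p2 n / pochhammer q2 n) *
      (pochhammer p3 n / pochhammer q3 n) * (pochhammer p4 n / fact n))"
    by (intro subexp_mult subexp_pochhammer_ratio subexp_pochhammer_fact)
  from subexp_holomorphic[OF this] show ?thesis
    unfolding hyp_series_def[abs_def] by (simp add: mult_ac)
qed

section \<open>Growth of Wilson polynomials\<close>

text \<open>The part of the j-th term that does not depend on the degree, kept apart so that
  differences in the degree act on the other two Pochhammer symbols only.\<close>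

definition wilson_ratio :: "complex \<Rightarrow> complex \<Rightarrow> complex \<Rightarrow> complex \<Rightarrow> complex \<Rightarrow> nat \<Rightarrow> complex" where
  "wilson_ratio x a b c d j = pochhammer (a + \<i> * x) j * pochhammer (a - \<i> * x) j /
     (pochhammer (a + b) j * pochhammer (a + c) j * pochhammer (a + d) j * fact j)"

text \<open>The terminating \<open>4F3\<close> without the normalizing prefactor of the Wilson
  polynomial.\<close>

definition wilson_hyp :: "complex \<Rightarrow> complex \<Rightarrow> complex \<Rightarrow> complex \<Rightarrow> complex \<Rightarrow> nat \<Rightarrow> complex" where
  "wilson_hyp x a b c d n = (\<Sum>j\<le>n. pochhammer (- of_nat n) j *
     pochhammer (of_nat n + a + b + c + d - 1) j * wilson_ratio x a b c d j)"

lemma wilson_eq: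
  "wilson n x a b c d =
     pochhammer (a + b) n * pochhammer (a + c) n * pochhammer (a + d) n * wilson_hyp x a b c d n"
proof -
  have "hyp_series [- of_nat n, of_nat n + a + b + c + d - 1, a + \<i> * x, a - \<i> * x] [a + b, a + c, a + d] 1
    = wilson_hyp x a b c d n"
    unfolding hyp_series_def wilson_hyp_def
    by (subst suminf_finite[of "{..n}"])
      (auto simp: wilson_ratio_def pochhammer_of_nat_eq_0_iff mult_ac intro!: sum.cong)
  then show ?thesis
    by (simp add: wilson_def)
qed

text \<open>A common upper limit lets polynomials of different degrees be compared term by
  term.\<close>

lemma wilson_hyp_extend:
  assumes "n \<le> N"
  shows "wilson_hyp x a b c d n = (\<Sum>j\<le>N. pochhammer (- of_nat n) j *
     pochhammer (of_nat n + a + b + c + d - 1) j * wilson_ratio x a b c d j)"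
  unfolding wilson_hyp_def
  by (rule sum.mono_neutral_left) (use assms in \<open>auto simp: pochhammer_of_nat_eq_0_iff\<close>)

section \<open>The three-term recurrence in the degree\<close>

text \<open>Since \<open>(a + j)\<^sup>2 + x\<^sup>2\<close> factors as
  \<open>(a + ix + j) (a - ix + j)\<close>, multiplication by it amounts to a shift of
  \<open>j\<close>. This is how the variable enters the recurrence.\<close>

lemma wilson_ratio_Suc:
  assumes "Re (a + b) > 0" "Re (a + c) > 0" "Re (a + d) > 0"
  shows "((a + of_nat j)\<^sup>2 + x\<^sup>2) * wilson_ratio x a b c d j =
    of_nat (Suc j) * (a + b + of_nat j) * (a + c + of_nat j) * (a + d + of_nat j) *
      wilson_ratio x a b c d (Suc j)"
proof -
  have nz: "w + of_nat j \<noteq> 0" if "Re w > 0" for w :: complex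
    using that by (auto simp: complex_eq_iff)
  note nz = nz[OF assms(1)] nz[OF assms(2)] nz[OF assms(3)]
  have nz1: "of_nat (Suc j) \<noteq> (0 :: complex)"
    by (simp del: of_nat_Suc)
  have "(a + of_nat j)\<^sup>2 + x\<^sup>2 = (a + \<i> * x + of_nat j) * (a - \<i> * x + of_nat j)"
    by (simp add: algebra_simps power2_eq_square)
  then show ?thesis
    unfolding wilson_ratio_def pochhammer_Suc fact_Suc using nz nz1
    by (simp add: mult_ac del: of_nat_Suc)
qed

text \<open>The coefficient comparison behind the recurrence, at \<open>j = i + 1\<close>. On the
  left stand the weights of the forward and backward differences; on the right, the first product
  comes from \<open>wilson_ratio_Suc\<close> and the second from the telescoping function.\<close>

lemma wilson_recurrence_coeff:
  fixes a b c d j n :: complex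
  shows "(n + a + b) * (n + a + c) * (n + a + d) * (n + (a + b + c + d) + j - 2)
       + (n + b + c - 1) * (n + b + d - 1) * (n + c + d - 1) * (- n + j - 1)
       = (2 * n + (a + b + c + d) - 1) * ((a + b + j - 1) * (a + c + j - 1) * (a + d + j - 1)
           - (2 * a + j) * (- n + j - 1) * (n + (a + b + c + d) + j - 2))"
  by algebra

text \<open>At index \<open>i + 1\<close> the products for degrees \<open>n + 1\<close> and
  \<open>n\<close> share the factor \<open>(-n)\<^sub>i (n + s)\<^sub>i\<close>, where
  \<open>s = a + b + c + d\<close>; the cofactors differ by \<open>-(2n + s) (i + 1)\<close>. The
  terms at index 0 cancel.\<close>

lemma wilson_hyp_diff:
  assumes "n \<le> N"
  shows "wilson_hyp x a b c d (Suc n) - wilson_hyp x a b c d n =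
     - ((2 * of_nat n + a + b + c + d) * (\<Sum>i\<le>N. of_nat (Suc i) * pochhammer (- of_nat n) i *
          pochhammer (of_nat n + a + b + c + d) i * wilson_ratio x a b c d (Suc i)))"
proof -
  let ?w = "wilson_ratio x a b c d"
  define s where "s = a + b + c + d"
  define e :: "nat \<Rightarrow> nat \<Rightarrow> complex" where
    "e n j = pochhammer (- of_nat n) j * pochhammer (of_nat n + s - 1) j" for n j
  have p: "wilson_hyp x a b c d m = (\<Sum>j\<le>Suc N. e m j * ?w j)" if "m \<le> Suc N" for m
    by (subst wilson_hyp_extend[OF that]) (simp add: e_def s_def algebra_simps)
  have e: "e (Suc n) (Suc i) - e n (Suc i) = - ((2 * of_nat n + s) * (of_nat (Suc i) *
      pochhammer (- of_nat n) i * pochhammer (of_nat n + s) i))" for i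
  proof -
    have "pochhammer (- of_nat (Suc n)) (Suc i) = (- of_nat n - 1) * pochhammer (- of_nat n :: complex) i"
      unfolding pochhammer_rec by simp
    moreover have "pochhammer (of_nat (Suc n) + s - 1) (Suc i) = pochhammer (of_nat n + s) i * (of_nat n + s + of_nat i)"
      unfolding pochhammer_Suc by simp
    moreover have "pochhammer (- of_nat n :: complex) (Suc i) = pochhammer (- of_nat n) i * (- of_nat n + of_nat i)"
      unfolding pochhammer_Suc by simp
    moreover have "pochhammer (of_nat n + s - 1) (Suc i) = (of_nat n + s - 1) * pochhammer (of_nat n + s) i"
      unfolding pochhammer_rec by simp
    moreover have "of_nat (Suc i) = (of_nat i + 1 :: complex)" by simp
    ultimately show ?thesis
      unfolding e_def by algebra
  qed
  have "wilson_hyp x a b c d (Suc n) - wilson_hyp x a b c d n = (\<Sum>j\<le>Suc N. (e (Suc n) j - e n j) * ?w j)"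
    using assms by (simp add: p left_diff_distrib sum_subtractf del: sum.atMost_Suc)
  also have "\<dots> = (\<Sum>i\<le>N. (e (Suc n) (Suc i) - e n (Suc i)) * ?w (Suc i))"
    by (subst sum.atMost_Suc_shift) (simp add: e_def)
  also have "\<dots> = - ((2 * of_nat n + s) * (\<Sum>i\<le>N. of_nat (Suc i) * pochhammer (- of_nat n) i *
          pochhammer (of_nat n + s) i * ?w (Suc i)))"
    unfolding e by (simp add: sum_distrib_left sum_negf mult_ac del: of_nat_Suc)
  finally show ?thesis
    by (simp add: s_def add.assoc)
qed

text \<open>
  Comparing coefficients of \<open>(a + ix)\<^sub>j (a - ix)\<^sub>j\<close>: the two sides differ by the telescoping sum of
  \<open>g i = i (2a + i) (-n)\<^sub>i (n + s - 1)\<^sub>i w\<^sub>i\<close>, which vanishes at both ends.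
\<close>
lemma wilson_hyp_recurrence:
  fixes a b c d x :: complex and m :: nat
  defines "s \<equiv> a + b + c + d" and "n \<equiv> of_nat (Suc m) :: complex"
  assumes re: "Re (a + b) > 0" "Re (a + c) > 0" "Re (a + d) > 0" and s: "Re s > 0"
  shows "(n + s - 1) * (n + a + b) * (n + a + c) * (n + a + d) * (2 * n + s - 2) *
           (wilson_hyp x a b c d (Suc (Suc m)) - wilson_hyp x a b c d (Suc m))
       = n * (n + b + c - 1) * (n + b + d - 1) * (n + c + d - 1) * (2 * n + s) *
           (wilson_hyp x a b c d (Suc m) - wilson_hyp x a b c d m)
         - (a\<^sup>2 + x\<^sup>2) * (2 * n + s - 1) * (2 * n + s) * (2 * n + s - 2) * wilson_hyp x a b c d (Suc m)"
proof -
  let ?w = "wilson_ratio x a b c d"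
  define N where "N = Suc m"
  define E where "E i = pochhammer (- n) i * pochhammer (n + s - 1) i" for i
  define U where "U = (\<Sum>i\<le>N. of_nat (Suc i) * pochhammer (- n) i * pochhammer (n + s) i * ?w (Suc i))"
  define V where "V = (\<Sum>i\<le>N. of_nat (Suc i) * pochhammer (1 - n) i * pochhammer (n + s - 1) i * ?w (Suc i))"
  \<comment> \<open>The factors \<open>n + s - 1\<close> and \<open>n\<close> of the claim turn
    \<open>U\<close> into \<open>X\<close> and \<open>V\<close> into \<open>- Y\<close>, so that all
    sums are expressed through the same products \<open>E i\<close>.\<close>
  define X where "X = (\<Sum>i\<le>N. of_nat (Suc i) * E i * (n + s - 1 + of_nat i) * ?w (Suc i))"
  define Y where "Y = (\<Sum>i\<le>N. of_nat (Suc i) * E i * (- n + of_nat i) * ?w (Suc i))"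
  have d1: "wilson_hyp x a b c d (Suc (Suc m)) - wilson_hyp x a b c d (Suc m) = - ((2 * n + s) * U)"
    by (subst wilson_hyp_diff[where N = N]) (simp_all add: N_def U_def n_def s_def add.assoc)
  have "1 - n = - of_nat m" "n + s - 1 = of_nat m + a + b + c + d"
    by (simp_all add: n_def s_def)
  then have d0: "wilson_hyp x a b c d (Suc m) - wilson_hyp x a b c d m = - ((2 * n + s - 2) * V)"
    unfolding V_def by (subst wilson_hyp_diff[where N = N]) (simp_all add: N_def s_def n_def add.assoc)
  have XU: "(n + s - 1) * U = X"
  proof -
    have h: "(n + s - 1) * (of_nat (Suc i) * pochhammer (- n) i * pochhammer (n + s) i * ?w (Suc i)) =
        of_nat (Suc i) * E i * (n + s - 1 + of_nat i) * ?w (Suc i)" for i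
    proof -
      have "(n + s - 1) * pochhammer (n + s) i = pochhammer (n + s - 1) i * (n + s - 1 + of_nat i)"
        using pochhammer_rec[of "n + s - 1" i] pochhammer_Suc[of "n + s - 1" i] by simp
      then show ?thesis
        unfolding E_def by algebra
    qed
    show ?thesis
      unfolding U_def X_def sum_distrib_left h ..
  qed
  have YV: "n * V = - Y"
  proof -
    have h: "n * (of_nat (Suc i) * pochhammer (1 - n) i * pochhammer (n + s - 1) i * ?w (Suc i)) =
        - (of_nat (Suc i) * E i * (- n + of_nat i) * ?w (Suc i))" for i
    proof -
      have "n * pochhammer (1 - n) i = - (pochhammer (- n) i * (- n + of_nat i))"
        using pochhammer_rec[of "- n" i] pochhammer_Suc[of "- n" i] by simp
      then show ?thesis
        unfolding E_def by algebra
    qed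
    show ?thesis
      unfolding V_def Y_def sum_distrib_left sum_negf[symmetric] h ..
  qed
  define g where "g i = of_nat i * (2 * a + of_nat i) * E i * ?w i" for i
  have trm: "(n + a + b) * (n + a + c) * (n + a + d) * (of_nat (Suc i) * E i * (n + s - 1 + of_nat i) * ?w (Suc i))
      + (n + b + c - 1) * (n + b + d - 1) * (n + c + d - 1) * (of_nat (Suc i) * E i * (- n + of_nat i) * ?w (Suc i))
      = (2 * n + s - 1) * ((a\<^sup>2 + x\<^sup>2) * (E i * ?w i) + (g i - g (Suc i)))" for i
  proof -
    define j :: complex where "j = of_nat (Suc i)"
    have i: "of_nat i = j - 1" by (simp add: j_def)
    have E: "E (Suc i) = E i * (- n + (j - 1)) * (n + s - 1 + (j - 1))"
      unfolding E_def pochhammer_Suc i by simp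
    have W: "((a + (j - 1))\<^sup>2 + x\<^sup>2) * ?w i =
       j * (a + b + (j - 1)) * (a + c + (j - 1)) * (a + d + (j - 1)) * ?w (Suc i)"
      using wilson_ratio_Suc[OF re, of i x] unfolding i j_def[symmetric] .
    have co: "(n + a + b) * (n + a + c) * (n + a + d) * (n + s + j - 2)
       + (n + b + c - 1) * (n + b + d - 1) * (n + c + d - 1) * (- n + j - 1)
       = (2 * n + s - 1) * ((a + b + j - 1) * (a + c + j - 1) * (a + d + j - 1)
           - (2 * a + j) * (- n + j - 1) * (n + s + j - 2))"
      unfolding s_def by (rule wilson_recurrence_coeff)
    define e w0 w1 where "e = E i" and "w0 = ?w i" and "w1 = ?w (Suc i)"
    have "(n + a + b) * (n + a + c) * (n + a + d) * (j * e * (n + s - 1 + (j - 1)) * w1)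
      + (n + b + c - 1) * (n + b + d - 1) * (n + c + d - 1) * (j * e * (- n + (j - 1)) * w1)
      = j * e * w1 * ((n + a + b) * (n + a + c) * (n + a + d) * (n + s + j - 2)
       + (n + b + c - 1) * (n + b + d - 1) * (n + c + d - 1) * (- n + j - 1))"
      by algebra
    also have "\<dots> = (2 * n + s - 1) * (e * (j * (a + b + (j - 1)) * (a + c + (j - 1)) * (a + d + (j - 1)) * w1)
        - j * (2 * a + j) * (e * (- n + (j - 1)) * (n + s - 1 + (j - 1))) * w1)"
      unfolding co by algebra
    also have "j * (a + b + (j - 1)) * (a + c + (j - 1)) * (a + d + (j - 1)) * w1 = ((a + (j - 1))\<^sup>2 + x\<^sup>2) * w0"
      using W unfolding w0_def w1_def by simp
    \<comment> \<open>Splitting \<open>(a + i)\<^sup>2 + x\<^sup>2\<close> into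
      \<open>a\<^sup>2 + x\<^sup>2\<close> and \<open>i (2a + i)\<close>, with
      \<open>i = j - 1\<close>, separates the multiple of the polynomial itself from
      \<open>g i\<close>.\<close>
    also have "(2 * n + s - 1) * (e * (((a + (j - 1))\<^sup>2 + x\<^sup>2) * w0)
        - j * (2 * a + j) * (e * (- n + (j - 1)) * (n + s - 1 + (j - 1))) * w1)
       = (2 * n + s - 1) * ((a\<^sup>2 + x\<^sup>2) * (e * w0) + ((j - 1) * (2 * a + (j - 1)) * e * w0
           - j * (2 * a + j) * (e * (- n + (j - 1)) * (n + s - 1 + (j - 1))) * w1))"
      by algebra
    finally show ?thesis
      unfolding g_def E i j_def[symmetric] e_def w0_def w1_def .
  qed
  have gN: "g 0 = 0" "g (Suc N) = 0"
    by (simp_all add: g_def E_def N_def n_def pochhammer_of_nat_eq_0_lemma del: of_nat_Suc)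
  have p: "wilson_hyp x a b c d (Suc m) = (\<Sum>i\<le>N. E i * ?w i)"
    unfolding wilson_hyp_def E_def N_def n_def s_def by (simp add: algebra_simps)
  have "(n + a + b) * (n + a + c) * (n + a + d) * X + (n + b + c - 1) * (n + b + d - 1) * (n + c + d - 1) * Y
     = (2 * n + s - 1) * ((a\<^sup>2 + x\<^sup>2) * wilson_hyp x a b c d (Suc m) + (\<Sum>i\<le>N. g i - g (Suc i)))"
    unfolding X_def Y_def p sum_distrib_left sum.distrib[symmetric] trm ..
  also have "(\<Sum>i\<le>N. g i - g (Suc i)) = 0"
    using sum_lessThan_telescope'[of g "Suc N"] gN by (simp add: lessThan_Suc_atMost)
  finally show ?thesis
    unfolding d0 d1 using XU YV by algebra
qed

text \<open>The limiting recurrence has 1 as a double characteristic root. Hence the terms and their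
  differences must be estimated together.\<close>

lemma subexp_second_order:
  fixes p :: "nat \<Rightarrow> complex"
  assumes rec: "\<And>n. p (Suc (Suc n)) - p (Suc n) = c n * (p (Suc n) - p n) + d n * p (Suc n)"
    and c: "c \<longlonglongrightarrow> 1" and d: "d \<longlonglongrightarrow> 0"
  shows "subexp p"
proof (rule subexpI)
  fix q :: real
  assume q: "q > 1"
  define \<epsilon> where "\<epsilon> = sqrt q - 1"
  have \<epsilon>: "\<epsilon> > 0" "(1 + \<epsilon>)\<^sup>2 = q"
    using q by (auto simp: \<epsilon>_def)
  \<comment> \<open>The weight \<open>1 / \<epsilon>\<close> balances the two parts: with
    \<open>norm (c n) < 1 + \<epsilon>\<close> and \<open>norm (d n) < \<epsilon>\<^sup>2\<close>,
    one step multiplies \<open>E\<close> by at most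
    \<open>(1 + \<epsilon>)\<^sup>2 = q\<close>.\<close>
  define E where "E n = norm (p n) + norm (p n - p (n - 1)) / \<epsilon>" for n
  have "\<forall>\<^sub>F n in sequentially. norm (c n) < 1 + \<epsilon>"
    using tendsto_norm[OF c] \<epsilon> by (intro order_tendstoD) auto
  moreover have "\<forall>\<^sub>F n in sequentially. norm (d n) < \<epsilon>\<^sup>2"
    using tendsto_norm[OF d] \<epsilon> by (intro order_tendstoD) auto
  ultimately have "\<forall>\<^sub>F n in sequentially. norm (p (Suc n)) \<le> E (Suc n) \<and> E (Suc (Suc n)) \<le> q * E (Suc n)"
  proof eventually_elim
    case (elim n)
    define P D D' where "P = norm (p (Suc n))" and "D = norm (p (Suc n) - p n)"
      and "D' = norm (p (Suc (Suc n)) - p (Suc n))"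
    have nn: "P \<ge> 0" "D \<ge> 0" by (simp_all add: P_def D_def)
    have "D' \<le> norm (c n) * D + norm (d n) * P"
      unfolding D'_def D_def P_def rec using norm_triangle_ineq by (metis norm_mult)
    also have "\<dots> \<le> (1 + \<epsilon>) * D + \<epsilon>\<^sup>2 * P"
      using elim nn by (intro add_mono mult_right_mono) auto
    finally have D': "D' \<le> (1 + \<epsilon>) * D + \<epsilon>\<^sup>2 * P" .
    have "norm (p (Suc (Suc n))) \<le> P + D'"
      using norm_triangle_ineq[of "p (Suc n)" "p (Suc (Suc n)) - p (Suc n)"] by (simp add: P_def D'_def)
    then have "E (Suc (Suc n)) \<le> P + D' * (1 + 1 / \<epsilon>)"
      by (simp add: E_def D'_def algebra_simps)
    also have "\<dots> \<le> P + ((1 + \<epsilon>) * D + \<epsilon>\<^sup>2 * P) * (1 + 1 / \<epsilon>)"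
      using D' \<epsilon> by (intro add_left_mono mult_right_mono) auto
    also have "\<dots> = (1 + \<epsilon>)\<^sup>2 * (P + D / \<epsilon>) - \<epsilon> * P"
      using \<epsilon>(1) by (simp add: field_simps power2_eq_square)
    also have "\<dots> \<le> q * E (Suc n)"
      using \<epsilon> nn by (simp add: E_def P_def D_def)
    finally show ?case
      using \<epsilon> by (simp add: E_def)
  qed
  then have "\<forall>\<^sub>F n in sequentially. norm (p n) \<le> E n \<and> E (Suc n) \<le> q * E n"
    by (subst (asm) eventually_sequentially_Suc)
  then show "\<exists>E. \<forall>\<^sub>F n in sequentially. norm (p n) \<le> E n \<and> E (Suc n) \<le> q * E n"
    by blast
qed

lemma subexp_wilson_hyp:
  fixes a b c d x :: complex
  assumes pos: "Re a > 0" "Re b > 0" "Re c > 0" "Re d > 0"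
  shows "subexp (wilson_hyp x a b c d)"
proof -
  define s where "s = a + b + c + d"
  have s: "Re s > 0"
    using pos by (simp add: s_def)
  \<comment> \<open>\<open>C\<close> and \<open>D\<close> are the coefficients of
    \<open>wilson_hyp_recurrence\<close> divided by the leading one, split into quotients of linear
    factors. In \<open>D\<close> the common factor \<open>2n + s - 2\<close> is cancelled, and two
    unmatched denominators force the limit 0.\<close>
  define C where "C k = of_nat k / (of_nat k + s - 1) * ((of_nat k + b + c - 1) / (of_nat k + a + b)) *
    ((of_nat k + b + d - 1) / (of_nat k + a + c)) * ((of_nat k + c + d - 1) / (of_nat k + a + d)) *
    ((2 * of_nat k + s) / (2 * of_nat k + s - 2))" for k
  define D where "D k = - (a\<^sup>2 + x\<^sup>2) * ((2 * of_nat k + s - 1) / (of_nat k + a + b)) *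
    ((2 * of_nat k + s) / (of_nat k + a + c)) * (1 / (of_nat k + s - 1)) * (1 / (of_nat k + a + d))" for k
  have lim1: "(\<lambda>k. (of_nat k + p) / (of_nat k + q)) \<longlonglongrightarrow> 1" for p q :: complex
    using tendsto_shift_ratio[of p q] by (simp add: add.commute)
  have lim0: "(\<lambda>k. 1 / (of_nat k + q)) \<longlonglongrightarrow> 0" for q :: complex
    using tendsto_divide_0[OF tendsto_const tendsto_add_filterlim_at_infinity[OF tendsto_const tendsto_of_nat]]
    by (simp add: add.commute)
  have C: "C \<longlonglongrightarrow> 1"
  proof -
    have "(\<lambda>k. (of_nat k + 0) / (of_nat k + (s - 1)) * ((of_nat k + (b + c - 1)) / (of_nat k + (a + b))) *
      ((of_nat k + (b + d - 1)) / (of_nat k + (a + c))) * ((of_nat k + (c + d - 1)) / (of_nat k + (a + d))) *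
      ((of_nat k + s / 2) / (of_nat k + (s / 2 - 1)))) \<longlonglongrightarrow> 1 * 1 * 1 * 1 * 1"
      by (intro tendsto_mult lim1)
    moreover have "(2 * of_nat k + s) / (2 * of_nat k + s - 2) =
        (of_nat k + s / 2) / (of_nat k + (s / 2 - 1))" for k
    proof -
      have "2 * of_nat k + s = 2 * (of_nat k + s / 2)" "2 * of_nat k + s - 2 = 2 * (of_nat k + (s / 2 - 1))"
        by (simp_all add: algebra_simps)
      then show ?thesis by (simp only: mult_divide_mult_cancel_left[of 2] zero_neq_numeral[symmetric] not_False_eq_True)
    qed
    ultimately show ?thesis
      unfolding C_def by (simp add: add.assoc add_diff_eq)
  qed
  have D: "D \<longlonglongrightarrow> 0"
  proof -
    have "(\<lambda>k. - (a\<^sup>2 + x\<^sup>2) * (2 * ((of_nat k + (s - 1) / 2) / (of_nat k + (a + b)))) *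
      (2 * ((of_nat k + s / 2) / (of_nat k + (a + c)))) * (1 / (of_nat k + (s - 1))) * (1 / (of_nat k + (a + d))))
      \<longlonglongrightarrow> - (a\<^sup>2 + x\<^sup>2) * (2 * 1) * (2 * 1) * 0 * 0"
      by (intro tendsto_mult lim1 lim0 tendsto_const)
    moreover have eq: "2 * ((of_nat k + (s - 1) / 2) / (of_nat k + (a + b))) = (2 * of_nat k + s - 1) / (of_nat k + a + b)"
      "2 * ((of_nat k + s / 2) / (of_nat k + (a + c))) = (2 * of_nat k + s) / (of_nat k + a + c)" for k
      by (simp_all add: distrib_left add.assoc add_diff_eq)
    ultimately show ?thesis
      unfolding D_def eq by (simp add: add.assoc add_diff_eq)
  qed
  show ?thesis
  proof (rule subexp_second_order)
    show "(\<lambda>m. C (Suc m)) \<longlonglongrightarrow> 1" "(\<lambda>m. D (Suc m)) \<longlonglongrightarrow> 0"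
      using C D by (simp_all add: LIMSEQ_Suc)
    fix m
    define n :: complex where "n = of_nat (Suc m)"
    define L where "L = (n + s - 1) * (n + a + b) * (n + a + c) * (n + a + d) * (2 * n + s - 2)"
    \<comment> \<open>The recurrence is centred at degree \<open>m + 1\<close>, so
      \<open>Re n\<close> is at least 1 and neither \<open>n + s - 1\<close> nor
      \<open>2n + s - 2\<close> can vanish.\<close>
    have re: "Re n \<ge> 1" by (simp add: n_def)
    have nz: "n + s - 1 \<noteq> 0" "n + a + b \<noteq> 0" "n + a + c \<noteq> 0" "n + a + d \<noteq> 0" "2 * n + s - 2 \<noteq> 0"
      using re s pos by (auto simp: complex_eq_iff)
    have "L \<noteq> 0" using nz by (simp add: L_def)
    have CL: "C (Suc m) * L = n * (n + b + c - 1) * (n + b + d - 1) * (n + c + d - 1) * (2 * n + s)"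
      unfolding C_def n_def[symmetric] L_def using nz by simp
    have DL: "D (Suc m) * L = - (a\<^sup>2 + x\<^sup>2) * (2 * n + s - 1) * (2 * n + s) * (2 * n + s - 2)"
      unfolding D_def n_def[symmetric] L_def using nz by simp
    let ?p = "wilson_hyp x a b c d"
    have "L * (?p (Suc (Suc m)) - ?p (Suc m)) = n * (n + b + c - 1) * (n + b + d - 1) * (n + c + d - 1) * (2 * n + s) *
         (?p (Suc m) - ?p m) - (a\<^sup>2 + x\<^sup>2) * (2 * n + s - 1) * (2 * n + s) * (2 * n + s - 2) * ?p (Suc m)"
      unfolding L_def n_def s_def by (rule wilson_hyp_recurrence) (use pos in simp_all)
    also have "\<dots> = L * (C (Suc m) * (?p (Suc m) - ?p m) + D (Suc m) * ?p (Suc m))"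
      using CL DL by algebra
    finally show "?p (Suc (Suc m)) - ?p (Suc m) = C (Suc m) * (?p (Suc m) - ?p m) + D (Suc m) * ?p (Suc m)"
      using \<open>L \<noteq> 0\<close> by simp
  qed
qed

section \<open>Connection coefficients\<close>

lemma pochhammer_minus_of_nat:
  assumes "j \<le> n"
  shows "pochhammer (- of_nat n) j / fact n = ((- 1) ^ j / fact (n - j) :: complex)"
proof -
  have "fact n = (pochhammer 1 (n - j) * pochhammer (of_nat n - of_nat j + 1) j :: complex)"
  proof -
    have e: "1 + of_nat (n - j) = (of_nat n - of_nat j + 1 :: complex)"
      using assms by (simp add: of_nat_diff)
    show ?thesis
      unfolding pochhammer_fact using pochhammer_product'[of "1 :: complex" "n - j" j, unfolded e] assms by simp
  qed
  then have "fact n = (fact (n - j) * pochhammer (of_nat n - of_nat j + 1) j :: complex)"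
    by (simp add: pochhammer_fact)
  moreover from this have "pochhammer (of_nat n - of_nat j + 1) j \<noteq> (0 :: complex)"
    using fact_nonzero[of n, where 'a = complex] by (metis mult_zero_right)
  ultimately show ?thesis
    by (simp add: pochhammer_minus)
qed

text \<open>With \<open>k = j + i\<close> and \<open>n = j + N\<close>, the term is a factor free of
  \<open>i\<close> times the summand of \<open>well_poised_5F4_sum\<close> at
  \<open>A = \<sigma> + 2j\<close>, \<open>C = a + h + j\<close> and
  \<open>e = d - h\<close>.\<close>

lemma wilson_hyp_connection_term:
  fixes a b c d h :: complex and i j N :: nat
  defines "\<sigma> \<equiv> a + b + c + h - 1" and "s \<equiv> a + b + c + d" and "k \<equiv> j + i" and "n \<equiv> j + N"
  assumes pos: "Re a > 0" "Re b > 0" "Re c > 0" "Re d > 0" "Re h > 0" and i: "i \<le> N"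
  shows "pochhammer (of_nat k + s - 1) k * pochhammer (s - 1) k * pochhammer (a + h) k /
          (pochhammer (of_nat k + \<sigma>) k * pochhammer (a + d) k * fact k) *
        (pochhammer (2 * of_nat k + s - 1) (n - k) * pochhammer (d - h) (n - k) * pochhammer (of_nat k + b + c) (n - k) /
          (pochhammer (2 * of_nat k + \<sigma> + 1) (n - k) * pochhammer (a + d + of_nat k) (n - k) * fact (n - k))) *
        (pochhammer (- of_nat k) j * pochhammer (of_nat k + \<sigma>) j) * (pochhammer (a + d) j / pochhammer (a + h) j)
      = (- 1) ^ j * pochhammer (s - 1) (n + j) / (fact N * pochhammer (a + d + of_nat j) N) *
        (of_nat (N choose i) * pochhammer (\<sigma> + 2 * of_nat j + (d - h) + of_nat N) i * pochhammer (a + h + of_nat j) i *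
         pochhammer (d - h) (N - i) * pochhammer (\<sigma> + 2 * of_nat j + 1 - (a + h + of_nat j) + of_nat i) (N - i) /
         (pochhammer (\<sigma> + 2 * of_nat j + of_nat i) i * pochhammer (\<sigma> + 2 * of_nat j + 2 * of_nat i + 1) (N - i)))"
proof -
  define M where "M = N - i"
  have M: "n - k = M" "n + k = 2 * k + M" "n + k = (n + j) + i" "n = k + M" "N = i + M"
    using i by (auto simp: M_def n_def k_def)
  \<comment> \<open>Both sides equal \<open>pochhammer (s - 1) (n + k)\<close>, split once at
    \<open>k\<close> and \<open>2k\<close> and once at \<open>n + j\<close>.\<close>
  have f1: "pochhammer (of_nat k + s - 1) k * pochhammer (s - 1) k * pochhammer (2 * of_nat k + s - 1) M =
     pochhammer (s - 1) (n + j) * pochhammer (\<sigma> + 2 * of_nat j + (d - h) + of_nat N) i"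
  proof -
    have e: "s - 1 + of_nat (n + j) = \<sigma> + 2 * of_nat j + (d - h) + of_nat N"
      "s - 1 + of_nat (k + k) = 2 * of_nat k + s - 1" "s - 1 + of_nat k = of_nat k + s - 1"
      by (simp_all add: n_def s_def \<sigma>_def)
    have "pochhammer (s - 1) (n + k) = pochhammer (s - 1) k * pochhammer (s - 1 + of_nat k) k * pochhammer (s - 1 + of_nat (k + k)) M"
      unfolding M(2) mult_2 pochhammer_product' by simp
    moreover have "pochhammer (s - 1) (n + k) = pochhammer (s - 1) (n + j) * pochhammer (s - 1 + of_nat (n + j)) i"
      unfolding M(3) by (rule pochhammer_product')
    ultimately show ?thesis
      unfolding e by algebra
  qed
  have pnz: "pochhammer w m \<noteq> 0" if "Re w > 0" for w :: complex and m
    using that by (rule pochhammer_nz)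
  have f2: "pochhammer (a + h) k / pochhammer (a + h) j = pochhammer (a + h + of_nat j) i"
    unfolding k_def pochhammer_product' using pnz[of "a + h" j] pos by simp
  have f3: "pochhammer (a + d) j / (pochhammer (a + d) k * pochhammer (a + d + of_nat k) M) =
      1 / pochhammer (a + d + of_nat j) N"
  proof -
    have "pochhammer (a + d) k * pochhammer (a + d + of_nat k) M = pochhammer (a + d) j * pochhammer (a + d + of_nat j) N"
      using M(4) by (simp add: n_def flip: pochhammer_product')
    then show ?thesis
      using pnz[of "a + d" j] pos by simp
  qed
  have f4: "of_nat k + b + c = \<sigma> + 2 * of_nat j + 1 - (a + h + of_nat j) + of_nat i"
    by (simp add: k_def \<sigma>_def)
  have f5: "pochhammer (of_nat k + \<sigma>) j / pochhammer (of_nat k + \<sigma>) k = 1 / pochhammer (\<sigma> + 2 * of_nat j + of_nat i) i"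
  proof -
    have "pochhammer (of_nat k + \<sigma>) k = pochhammer (of_nat k + \<sigma>) j * pochhammer (of_nat k + \<sigma> + of_nat j) i"
      using pochhammer_product'[of "of_nat k + \<sigma>" j i] by (simp add: k_def)
    moreover have "of_nat k + \<sigma> + of_nat j = \<sigma> + 2 * of_nat j + of_nat i"
      by (simp add: k_def)
    \<comment> \<open>For \<open>j = 0\<close> the symbol is 1, whereas its base may then be
      \<open>\<sigma>\<close>, which can vanish. For \<open>j > 0\<close> also \<open>k > 0\<close>,
      and the base has positive real part.\<close>
    moreover have "pochhammer (of_nat k + \<sigma>) j \<noteq> 0"
      using pos by (cases "j = 0") (auto intro!: pnz simp: k_def \<sigma>_def)
    ultimately show ?thesis by simp
  qed
  have f6: "2 * of_nat k + \<sigma> + 1 = \<sigma> + 2 * of_nat j + 2 * of_nat i + 1"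
    by (simp add: k_def)
  have f7: "pochhammer (- of_nat k) j / fact k = ((- 1) ^ j / fact i :: complex)"
    using pochhammer_minus_of_nat[of j k] by (simp add: k_def)
  have f8: "of_nat (N choose i) / fact N = (1 / (fact i * fact M) :: complex)"
    using i by (simp add: binomial_fact M_def)
  have "pochhammer (of_nat k + s - 1) k * pochhammer (s - 1) k * pochhammer (a + h) k /
          (pochhammer (of_nat k + \<sigma>) k * pochhammer (a + d) k * fact k) *
        (pochhammer (2 * of_nat k + s - 1) M * pochhammer (d - h) M * pochhammer (of_nat k + b + c) M /
          (pochhammer (2 * of_nat k + \<sigma> + 1) M * pochhammer (a + d + of_nat k) M * fact M)) *
        (pochhammer (- of_nat k) j * pochhammer (of_nat k + \<sigma>) j) * (pochhammer (a + d) j / pochhammer (a + h) j)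
     = (pochhammer (of_nat k + s - 1) k * pochhammer (s - 1) k * pochhammer (2 * of_nat k + s - 1) M) *
       (pochhammer (a + h) k / pochhammer (a + h) j) *
       (pochhammer (a + d) j / (pochhammer (a + d) k * pochhammer (a + d + of_nat k) M)) *
       (pochhammer (of_nat k + \<sigma>) j / pochhammer (of_nat k + \<sigma>) k) * (pochhammer (- of_nat k) j / fact k) *
       (pochhammer (d - h) M * pochhammer (of_nat k + b + c) M) / (pochhammer (2 * of_nat k + \<sigma> + 1) M * fact M)"
    by (simp add: divide_inverse mult_ac)
  also have "\<dots> = (- 1) ^ j * pochhammer (s - 1) (n + j) / (pochhammer (a + d + of_nat j) N) * (1 / (fact i * fact M)) *
        (pochhammer (\<sigma> + 2 * of_nat j + (d - h) + of_nat N) i * pochhammer (a + h + of_nat j) i *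
         pochhammer (d - h) M * pochhammer (\<sigma> + 2 * of_nat j + 1 - (a + h + of_nat j) + of_nat i) M /
         (pochhammer (\<sigma> + 2 * of_nat j + of_nat i) i * pochhammer (\<sigma> + 2 * of_nat j + 2 * of_nat i + 1) M))"
    unfolding f1 f2 f3 f4 f5 f6 f7 by (simp add: divide_inverse mult_ac)
  finally show ?thesis
    unfolding f8[symmetric] M(1) M_def[symmetric] by (simp add: divide_inverse mult_ac)
qed

text \<open>Both sides are finite combinations of \<open>wilson_ratio x a b c d j\<close>, and the
  coefficients agree for each \<open>j\<close>. Replacing \<open>h\<close> by \<open>d\<close> in
  \<open>wilson_ratio\<close> costs only the factor
  \<open>(a + d)\<^sub>j / (a + h)\<^sub>j\<close>.\<close>

lemma wilson_hyp_connection: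
  fixes a b c d h x :: complex
  defines "s \<equiv> a + b + c + d" and "\<sigma> \<equiv> a + b + c + h - 1"
  assumes pos: "Re a > 0" "Re b > 0" "Re c > 0" "Re d > 0" "Re h > 0"
  shows "pochhammer (s - 1) n / fact n * wilson_hyp x a b c d n =
     (\<Sum>k\<le>n. pochhammer (of_nat k + s - 1) k * pochhammer (s - 1) k * pochhammer (a + h) k /
          (pochhammer (of_nat k + \<sigma>) k * pochhammer (a + d) k * fact k) *
        (pochhammer (2 * of_nat k + s - 1) (n - k) * pochhammer (d - h) (n - k) * pochhammer (of_nat k + b + c) (n - k) /
          (pochhammer (2 * of_nat k + \<sigma> + 1) (n - k) * pochhammer (a + d + of_nat k) (n - k) * fact (n - k))) *
        wilson_hyp x a b c h k)"
    (is "_ = (\<Sum>k\<le>n. ?K k * _)")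
proof -
  have coeff: "(\<Sum>k\<le>n. ?K k * (pochhammer (- of_nat k) j * pochhammer (of_nat k + \<sigma>) j * wilson_ratio x a b c h j)) =
     pochhammer (s - 1) n / fact n * (pochhammer (- of_nat n) j * pochhammer (of_nat n + s - 1) j * wilson_ratio x a b c d j)"
    if j: "j \<le> n" for j
  proof -
    define N where "N = n - j"
    have n: "n = j + N" using j by (simp add: N_def)
    have pnz: "pochhammer w m \<noteq> 0" if "Re w > 0" for w :: complex and m
      using that by (rule pochhammer_nz)
    have w: "wilson_ratio x a b c h j = pochhammer (a + d) j / pochhammer (a + h) j * wilson_ratio x a b c d j"
      unfolding wilson_ratio_def using pnz[of "a + d" j] pos by simp
    \<comment> \<open>The terms with \<open>k < j\<close> vanish because of
      \<open>(-k)\<^sub>j\<close>; the shift \<open>k = j + i\<close> then leads to the well-poised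
      form.\<close>
    have "(\<Sum>k\<le>n. ?K k * (pochhammer (- of_nat k) j * pochhammer (of_nat k + \<sigma>) j) * (pochhammer (a + d) j / pochhammer (a + h) j))
       = (\<Sum>k\<in>{j..n}. ?K k * (pochhammer (- of_nat k) j * pochhammer (of_nat k + \<sigma>) j) * (pochhammer (a + d) j / pochhammer (a + h) j))"
      by (rule sum.mono_neutral_right) (auto simp: pochhammer_of_nat_eq_0_lemma)
    also have "\<dots> = (\<Sum>i\<le>N. ?K (j + i) * (pochhammer (- of_nat (j + i)) j * pochhammer (of_nat (j + i) + \<sigma>) j) * (pochhammer (a + d) j / pochhammer (a + h) j))"
      by (rule sum.reindex_bij_witness[where i = "\<lambda>i. j + i" and j = "\<lambda>k. k - j"]) (auto simp: n)
    also have "\<dots> = (\<Sum>i\<le>N. (- 1) ^ j * pochhammer (s - 1) (n + j) / (fact N * pochhammer (a + d + of_nat j) N) *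
        (of_nat (N choose i) * pochhammer (\<sigma> + 2 * of_nat j + (d - h) + of_nat N) i * pochhammer (a + h + of_nat j) i *
         pochhammer (d - h) (N - i) * pochhammer (\<sigma> + 2 * of_nat j + 1 - (a + h + of_nat j) + of_nat i) (N - i) /
         (pochhammer (\<sigma> + 2 * of_nat j + of_nat i) i * pochhammer (\<sigma> + 2 * of_nat j + 2 * of_nat i + 1) (N - i))))"
      unfolding n s_def \<sigma>_def
      by (intro sum.cong refl wilson_hyp_connection_term pos) simp
    \<comment> \<open>Here \<open>C + e = a + d + j\<close>, so the value of the sum cancels the
      denominator. The hypothesis on \<open>A = \<sigma> + 2j\<close> holds because
      \<open>\<sigma> + 1\<close> has positive real part.\<close>
    also have "\<dots> = (- 1) ^ j * pochhammer (s - 1) (n + j) / (fact N * pochhammer (a + d + of_nat j) N) *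
        pochhammer (a + h + of_nat j + (d - h)) N"
      unfolding sum_distrib_left[symmetric]
      by (subst well_poised_5F4_sum) (use pos in \<open>auto simp: \<sigma>_def\<close>)
    also have "a + h + of_nat j + (d - h) = a + d + of_nat j" by simp
    also have "(- 1) ^ j * pochhammer (s - 1) (n + j) / (fact N * pochhammer (a + d + of_nat j) N) *
        pochhammer (a + d + of_nat j) N = (- 1) ^ j / fact N * (pochhammer (s - 1) n * pochhammer (of_nat n + s - 1) j)"
    proof -
      have e: "s - 1 + of_nat n = of_nat n + s - 1" by simp
      show ?thesis
        unfolding pochhammer_product' e using pnz[of "a + d + of_nat j" N] pos by simp
    qed
    also have "(- 1) ^ j / fact N = (pochhammer (- of_nat n) j / fact n :: complex)"
      using pochhammer_minus_of_nat[OF j] by (simp add: N_def)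
    finally have "(\<Sum>k\<le>n. ?K k * (pochhammer (- of_nat k) j * pochhammer (of_nat k + \<sigma>) j) * (pochhammer (a + d) j / pochhammer (a + h) j)) * wilson_ratio x a b c d j
       = pochhammer (- of_nat n) j / fact n * (pochhammer (s - 1) n * pochhammer (of_nat n + s - 1) j) * wilson_ratio x a b c d j"
      by (rule arg_cong)
    then show ?thesis
      unfolding w sum_distrib_right by (simp add: mult.assoc mult_ac)
  qed
  have p: "wilson_hyp x a b c h k = (\<Sum>j\<le>n. pochhammer (- of_nat k) j * pochhammer (of_nat k + \<sigma>) j * wilson_ratio x a b c h j)"
    if "k \<le> n" for k
    using wilson_hyp_extend[OF that] by (simp add: \<sigma>_def algebra_simps)
  have "(\<Sum>k\<le>n. ?K k * wilson_hyp x a b c h k) = (\<Sum>k\<le>n. \<Sum>j\<le>n. ?K k *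
     (pochhammer (- of_nat k) j * pochhammer (of_nat k + \<sigma>) j * wilson_ratio x a b c h j))"
    by (intro sum.cong refl) (simp add: p sum_distrib_left)
  also have "\<dots> = (\<Sum>j\<le>n. \<Sum>k\<le>n. ?K k *
     (pochhammer (- of_nat k) j * pochhammer (of_nat k + \<sigma>) j * wilson_ratio x a b c h j))"
    by (rule sum.swap)
  also have "\<dots> = (\<Sum>j\<le>n. pochhammer (s - 1) n / fact n * (pochhammer (- of_nat n) j * pochhammer (of_nat n + s - 1) j * wilson_ratio x a b c d j))"
    by (intro sum.cong refl coeff) simp
  also have "\<dots> = pochhammer (s - 1) n / fact n * wilson_hyp x a b c d n"
    unfolding wilson_hyp_def sum_distrib_left[symmetric] s_def by (simp add: algebra_simps)
  finally show ?thesis ..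
qed

section \<open>The generating function\<close>

text \<open>The inverse of \<open>\<rho> \<mapsto> -4\<rho> / (1 - \<rho>)\<^sup>2\<close>: for this
  image \<open>z\<close> one has \<open>1 - z = ((1 + \<rho>) / (1 - \<rho>))\<^sup>2\<close>, so
  the principal root leads to the right half-plane and a Cayley transform back to the disk.\<close>

definition slit_to_disk :: "complex \<Rightarrow> complex" where
  "slit_to_disk z = (csqrt (1 - z) - 1) / (csqrt (1 - z) + 1)"

lemma one_minus_slit_plane:
  assumes "z \<in> slit_plane"
  shows "1 - z \<notin> \<real>\<^sub>\<le>\<^sub>0"
proof
  assume "1 - z \<in> \<real>\<^sub>\<le>\<^sub>0"
  then obtain r where "r \<le> 0" "1 - z = of_real r"
    by (auto elim: nonpos_Reals_cases)
  then have "z = complex_of_real (1 - r)" "1 - r \<ge> 1"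
    by (auto simp: algebra_simps)
  with assms show False
    unfolding slit_plane_def by blast
qed

lemma Re_csqrt_slit_plane:
  assumes "z \<in> slit_plane"
  shows "Re (csqrt (1 - z)) > 0"
proof -
  have "Re (csqrt (1 - z)) \<noteq> 0"
  proof
    define y where "y = Im (csqrt (1 - z))"
    assume "Re (csqrt (1 - z)) = 0"
    then have "csqrt (1 - z) = \<i> * of_real y"
      by (simp add: complex_eq_iff y_def)
    then have "(csqrt (1 - z))\<^sup>2 = of_real (- (y\<^sup>2))"
      by (simp add: power_mult_distrib)
    then have "1 - z = of_real (- (y\<^sup>2))"
      unfolding power2_csqrt .
    then have "1 - z \<in> \<real>\<^sub>\<le>\<^sub>0"
      by (simp only: nonpos_Reals_of_real_iff) simp
    with one_minus_slit_plane[OF assms] show False ..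
  qed
  then show ?thesis
    using csqrt_principal[of "1 - z"] by auto
qed

text \<open>A point of the right half-plane is closer to 1 than to -1.\<close>

lemma norm_cayley_less_1:
  assumes "Re w > 0"
  shows "norm ((w - 1) / (w + 1)) < 1"
proof -
  have "(norm (w - 1))\<^sup>2 < (norm (w + 1))\<^sup>2"
    using assms unfolding cmod_power2 by (simp add: power2_eq_square algebra_simps)
  then have "norm (w - 1) < norm (w + 1)"
    using power2_less_imp_less norm_ge_zero by blast
  moreover from this have "0 < norm (w + 1)"
    using norm_ge_zero le_less_trans by blast
  ultimately show ?thesis
    by (simp add: norm_divide)
qed

lemma slit_to_disk:
  assumes "z \<in> slit_plane"
  shows "norm (slit_to_disk z) < 1" "- 4 * slit_to_disk z / (1 - slit_to_disk z)\<^sup>2 = z"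
proof -
  define w where "w = csqrt (1 - z)"
  have w: "Re w > 0" "w\<^sup>2 = 1 - z"
    using Re_csqrt_slit_plane[OF assms] by (simp_all add: w_def)
  have "Re (w + 1) \<noteq> 0"
    using w by simp
  then have nz: "w + 1 \<noteq> 0"
    by (metis zero_complex.sel(1))
  show "norm (slit_to_disk z) < 1"
    using norm_cayley_less_1[OF w(1)] by (simp add: slit_to_disk_def w_def)
  have *: "1 - slit_to_disk z = 2 / (w + 1)"
    using nz by (simp add: slit_to_disk_def field_simps flip: w_def)
  have "- 4 * slit_to_disk z / (1 - slit_to_disk z)\<^sup>2 = - ((w - 1) * (w + 1))"
  proof -
    have "(w - 1) / (w + 1) * (w + 1)\<^sup>2 = (w - 1) * (w + 1)"
      using nz by (simp add: power2_eq_square)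
    moreover have "- 4 * X / (2 / Y)\<^sup>2 = - (X * Y\<^sup>2)" for X Y :: complex
      by (simp add: power_divide)
    ultimately show ?thesis
      unfolding * unfolding slit_to_disk_def w_def[symmetric] by (simp only:)
  qed
  also have "\<dots> = z"
    using w(2) by (simp add: algebra_simps power2_eq_square)
  finally show "- 4 * slit_to_disk z / (1 - slit_to_disk z)\<^sup>2 = z" .
qed

lemma disk_to_slit:
  assumes "norm \<rho> < 1"
  shows "- 4 * \<rho> / (1 - \<rho>)\<^sup>2 \<in> slit_plane" "slit_to_disk (- 4 * \<rho> / (1 - \<rho>)\<^sup>2) = \<rho>"
proof -
  define z where "z = - 4 * \<rho> / (1 - \<rho>)\<^sup>2"
  define w where "w = (1 + \<rho>) / (1 - \<rho>)"
  have nz: "1 - \<rho> \<noteq> 0" using assms by auto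
  have zw: "1 - z = w\<^sup>2"
  proof -
    have "1 - z = ((1 - \<rho>)\<^sup>2 + 4 * \<rho>) / (1 - \<rho>)\<^sup>2"
      using nz by (simp add: z_def add_divide_distrib)
    also have "(1 - \<rho>)\<^sup>2 + 4 * \<rho> = (1 + \<rho>)\<^sup>2"
      by algebra
    finally show ?thesis
      by (simp add: w_def power_divide)
  qed
  have "Re w = (1 - (norm \<rho>)\<^sup>2) / (norm (1 - \<rho>))\<^sup>2"
    unfolding w_def Re_divide' cmod_power2[of \<rho>] by (simp add: power2_eq_square algebra_simps)
  moreover have "(norm \<rho>)\<^sup>2 < 1"
    using assms by (simp add: abs_square_less_1)
  ultimately have w: "Re w > 0"
    using nz by simp
  then have sq: "csqrt (1 - z) = w"
    unfolding zw by (intro csqrt_square) simp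
  \<comment> \<open>On the cut, \<open>1 - z\<close> is a nonpositive real, whose principal root has
    real part 0; but this root is \<open>w\<close>.\<close>
  have "z \<in> slit_plane"
  proof (rule ccontr)
    assume "z \<notin> slit_plane"
    then obtain t where "t \<ge> 1" "z = of_real t"
      by (auto simp: slit_plane_def)
    then have "1 - z = of_real (1 - t)" "1 - t \<le> 0"
      by simp_all
    then have "Re (csqrt (1 - z)) = 0"
      by (simp only: csqrt_of_real_nonpos) simp
    with w show False
      unfolding sq by simp
  qed
  then show "- 4 * \<rho> / (1 - \<rho>)\<^sup>2 \<in> slit_plane"
    by (simp add: z_def)
  have "w + 1 = 2 / (1 - \<rho>)" "w - 1 = 2 * \<rho> / (1 - \<rho>)"
    using nz by (simp_all add: w_def field_simps)
  then show "slit_to_disk (- 4 * \<rho> / (1 - \<rho>)\<^sup>2) = \<rho>"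
    unfolding z_def[symmetric] slit_to_disk_def sq using nz by simp
qed

lemma slit_to_disk_holomorphic: "slit_to_disk holomorphic_on slit_plane"
proof -
  have "csqrt (1 - z) + 1 \<noteq> 0" if "z \<in> slit_plane" for z
  proof
    assume "csqrt (1 - z) + 1 = 0"
    then have "csqrt (1 - z) = - 1"
      by (simp only: eq_neg_iff_add_eq_0)
    with Re_csqrt_slit_plane[OF that] show False
      by (metis one_complex.sel(1) uminus_complex.sel(1) neg_0_less_iff_less not_one_less_zero)
  qed
  then show ?thesis
    unfolding slit_to_disk_def using one_minus_slit_plane
    by (intro holomorphic_intros) auto
qed

section \<open>The left-hand side as a power series in \<rho>\<close>

text \<open>The j-th term of the \<open>4F3\<close> carries the power
  \<open>(1 - \<rho>) powr (1 - s - 2j)\<close>; expanding it by the binomial series gives a double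
  series that is summed along diagonals. The radius 1/10 ensures \<open>4r < (1 - r)\<^sup>2\<close>
  for \<open>r = norm \<rho>\<close>, as absolute convergence requires.\<close>

lemma wilson_generating_function_near_0:
  fixes a b c d x \<rho> :: complex
  defines "s \<equiv> a + b + c + d"
  assumes \<rho>: "norm \<rho> < 1 / 10"
  shows "(\<lambda>n. pochhammer (s - 1) n / fact n * wilson_hyp x a b c d n * \<rho> ^ n) sums
     ((1 - \<rho>) powr (1 - s) * hyp_series [(s - 1) / 2, s / 2, a + \<i> * x, a - \<i> * x]
        [a + b, a + c, a + d] (- 4 * \<rho> / (1 - \<rho>)\<^sup>2))"
proof -
  define w where "w = wilson_ratio x a b c d"
  define u where "u j = pochhammer ((s - 1) / 2) j * pochhammer (s / 2) j * w j" for j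
  define r where "r = norm \<rho>"
  define M where "M = norm (s - 1)"
  define z where "z = - 4 * \<rho> / (1 - \<rho>)\<^sup>2"
  define q where "q = 4 * r / (1 - r)\<^sup>2"
  have r: "0 \<le> r" "r < 1 / 10" using \<rho> by (simp_all add: r_def)
  have nz: "1 - \<rho> \<noteq> 0" using \<rho> by auto
  have "(9 / 10)\<^sup>2 \<le> (1 - r)\<^sup>2" using r by (intro power_mono) auto
  then have q: "0 \<le> q" "q < 1"
    using r by (auto simp: q_def divide_simps power2_eq_square)
  have "norm z \<le> q"
  proof -
    have "1 - r \<le> norm (1 - \<rho>)"
      using norm_triangle_ineq2[of 1 \<rho>] by (simp add: r_def)
    then have "(1 - r)\<^sup>2 \<le> (norm (1 - \<rho>))\<^sup>2"
      using r by (intro power_mono) auto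
    then have "4 * r / (norm (1 - \<rho>))\<^sup>2 \<le> q"
      unfolding q_def using r by (intro divide_left_mono mult_pos_pos) auto
    then show ?thesis
      by (simp add: z_def norm_divide norm_mult norm_power r_def)
  qed
  with q have z: "norm z < 1" by simp
  have "subexp (\<lambda>j. (pochhammer ((s - 1) / 2) j / pochhammer (a + b) j) * (pochhammer (s / 2) j / pochhammer (a + c) j) *
      (pochhammer (a + \<i> * x) j / pochhammer (a + d) j) * (pochhammer (a - \<i> * x) j / fact j))"
    by (intro subexp_mult subexp_pochhammer_ratio subexp_pochhammer_fact)
  then have u: "subexp u"
    by (rule subexp_mono) (simp add: u_def w_def wilson_ratio_def norm_mult norm_divide mult_ac)
  have hyp: "hyp_series [(s - 1) / 2, s / 2, a + \<i> * x, a - \<i> * x] [a + b, a + c, a + d] z = (\<Sum>j. u j * z ^ j)"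
    unfolding hyp_series_def u_def w_def wilson_ratio_def by (simp add: mult_ac)
  define F where "F j m = u j * (- 4 * \<rho>) ^ j * (pochhammer (s - 1 + 2 * of_nat j) m / fact m * \<rho> ^ m)" for j m
  have row: "F j sums ((1 - \<rho>) powr (1 - s) * (u j * z ^ j))" for j
  proof -
    have "F j sums (u j * (- 4 * \<rho>) ^ j * (1 - \<rho>) powr (- (s - 1 + 2 * of_nat j)))"
      unfolding F_def by (intro sums_mult neg_binomial_complex) (use \<rho> in simp)
    also have "(1 - \<rho>) powr (- (s - 1 + 2 * of_nat j)) = (1 - \<rho>) powr (1 - s - of_nat (2 * j))"
      by (simp add: algebra_simps)
    also have "\<dots> = (1 - \<rho>) powr (1 - s) / (1 - \<rho>) ^ (2 * j)"
    proof -
      have "(1 - \<rho>) powr of_nat (2 * j) = (1 - \<rho>) ^ (2 * j)"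
        using nz by (intro powr_nat') simp
      then show ?thesis
        by (simp only: powr_diff[of _ "1 - s"])
    qed
    finally have F: "F j sums (u j * (- 4 * \<rho>) ^ j * ((1 - \<rho>) powr (1 - s) / (1 - \<rho>) ^ (2 * j)))" .
    have "z ^ j = (- 4 * \<rho>) ^ j / (1 - \<rho>) ^ (2 * j)"
      unfolding z_def power_divide power_mult ..
    with F show ?thesis
      by (simp add: mult_ac)
  qed
  \<comment> \<open>Replacing \<open>s - 1\<close> by its norm \<open>M\<close> and
    \<open>\<rho>\<close> by \<open>r\<close> gives a binomial series again. Up to a constant, the
    row bounds are the terms of the power series with coefficients \<open>norm (u j)\<close> at
    \<open>q < 1\<close>.\<close>
  have nrow: "summable (\<lambda>m. norm (F j m)) \<and> (\<Sum>m. norm (F j m)) \<le> (1 - r) powr (- M) * (norm (u j) * q ^ j)" for j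
  proof -
    define C where "C = norm (u j) * (4 * r) ^ j"
    have le: "norm (F j m) \<le> C * (pochhammer (M + 2 * real j) m / fact m * r ^ m)" for m
    proof -
      have "norm (pochhammer (s - 1 + 2 * of_nat j) m) \<le> pochhammer (M + 2 * real j) m"
        using norm_triangle_ineq[of "s - 1" "2 * of_nat j"]
        by (intro norm_pochhammer_le) (simp add: M_def norm_mult)
      then have "C * (norm (pochhammer (s - 1 + 2 * of_nat j) m) / fact m * r ^ m) \<le>
          C * (pochhammer (M + 2 * real j) m / fact m * r ^ m)"
        using r by (intro mult_left_mono mult_right_mono divide_right_mono) (auto simp: C_def)
      then show ?thesis
        by (simp add: F_def C_def norm_mult norm_divide norm_power r_def)
    qed
    have sm: "(\<lambda>m. C * (pochhammer (M + 2 * real j) m / fact m * r ^ m)) sums (C * (1 - r) powr (- (M + 2 * real j)))"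
      using r by (intro sums_mult neg_binomial_real) auto
    have summ: "summable (\<lambda>m. norm (F j m))"
      by (rule summable_comparison_test'[OF sums_summable[OF sm]]) (use le in simp)
    have "(\<Sum>m. norm (F j m)) \<le> C * (1 - r) powr (- (M + 2 * real j))"
      using suminf_le[OF le summ sums_summable[OF sm]] sums_unique[OF sm] by simp
    also have "(1 - r) powr (- (M + 2 * real j)) = (1 - r) powr (- M) / (1 - r) ^ (2 * j)"
    proof -
      have "- (M + 2 * real j) = - M - real (2 * j)" by simp
      moreover have "(1 - r) powr real (2 * j) = (1 - r) ^ (2 * j)"
        using r by (intro powr_realpow) simp
      ultimately show ?thesis
        by (simp only: powr_diff)
    qed
    finally have le: "(\<Sum>m. norm (F j m)) \<le> C * ((1 - r) powr (- M) / (1 - r) ^ (2 * j))" .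
    have "q ^ j = (4 * r) ^ j / (1 - r) ^ (2 * j)"
      unfolding q_def power_divide power_mult ..
    then have "C * ((1 - r) powr (- M) / (1 - r) ^ (2 * j)) = (1 - r) powr (- M) * (norm (u j) * q ^ j)"
      by (simp add: C_def)
    with summ le show ?thesis
      by simp
  qed
  have summ: "summable (\<lambda>j. (1 - r) powr (- M) * (norm (u j) * q ^ j))"
    by (intro summable_mult subexp_summable u q)
  obtain S where S: "(\<lambda>j. \<Sum>m. F j m) sums S" "(\<lambda>n. \<Sum>j\<le>n. F j (n - j)) sums S"
    by (rule sums_triangle[OF conjunct1[OF nrow] conjunct2[OF nrow] summ])
  have row_eq: "(\<Sum>m. F j m) = (1 - \<rho>) powr (1 - s) * (u j * z ^ j)" for j
    by (rule sums_unique[OF row, symmetric])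
  have "(\<lambda>j. (1 - \<rho>) powr (1 - s) * (u j * z ^ j)) sums S"
    using S(1) unfolding row_eq .
  moreover have "(\<lambda>j. (1 - \<rho>) powr (1 - s) * (u j * z ^ j)) sums ((1 - \<rho>) powr (1 - s) * (\<Sum>j. u j * z ^ j))"
    by (intro sums_mult summable_sums subexp_summable_complex u z)
  ultimately have Seq: "S = (1 - \<rho>) powr (1 - s) * (\<Sum>j. u j * z ^ j)"
    by (rule sums_unique2)
  have "(\<Sum>j\<le>n. F j (n - j)) = pochhammer (s - 1) n / fact n * wilson_hyp x a b c d n * \<rho> ^ n" for n
  proof -
    \<comment> \<open>The duplication formula merges the two half-parameters into
      \<open>(s - 1)\<^sub>2\<^sub>j\<close>. Together with the binomial coefficient this is
      \<open>(s - 1)\<^sub>n\<^sub>+\<^sub>j\<close>, which splits again at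
      \<open>n\<close>.\<close>
    have t: "F j (n - j) = pochhammer (s - 1) n / fact n * (pochhammer (- of_nat n) j *
     pochhammer (of_nat n + a + b + c + d - 1) j * w j) * \<rho> ^ n" if j: "j \<le> n" for j
    proof -
      have "pochhammer (s - 1) (2 * j) = 4 ^ j * (pochhammer ((s - 1) / 2) j * pochhammer (s / 2) j)"
      proof -
        have e: "2 * ((s - 1) / 2) = s - 1" "(s - 1) / 2 + 1 / 2 = s / 2"
          by (simp_all add: field_simps)
        show ?thesis
          using pochhammer_double[of "(s - 1) / 2" j] unfolding e by (simp add: power_mult)
      qed
      moreover have "pochhammer (s - 1) (2 * j) * pochhammer (s - 1 + 2 * of_nat j) (n - j) =
        pochhammer (s - 1) n * pochhammer (of_nat n + a + b + c + d - 1) j"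
      proof -
        have "pochhammer (s - 1) (2 * j + (n - j)) = pochhammer (s - 1) (2 * j) * pochhammer (s - 1 + 2 * of_nat j) (n - j)"
          unfolding pochhammer_product' by simp
        moreover have e: "2 * j + (n - j) = n + j" using j by simp
        have e': "s - 1 + of_nat n = of_nat n + a + b + c + d - 1"
          by (simp add: s_def)
        ultimately show ?thesis
          unfolding e pochhammer_product' e' by simp
      qed
      ultimately have P: "4 ^ j * (pochhammer ((s - 1) / 2) j * pochhammer (s / 2) j) * pochhammer (s - 1 + 2 * of_nat j) (n - j) =
        pochhammer (s - 1) n * pochhammer (of_nat n + a + b + c + d - 1) j"
        by metis
      have e1: "\<rho> ^ n = \<rho> ^ j * \<rho> ^ (n - j)"
        using j by (simp flip: power_add)
      have e2: "(- 4 * \<rho>) ^ j = (- 1) ^ j * 4 ^ j * \<rho> ^ j"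
        unfolding power_mult_distrib[symmetric] by simp
      define U where "U = pochhammer ((s - 1) / 2) j * pochhammer (s / 2) j"
      define V where "V = pochhammer (s - 1 + 2 * of_nat j) (n - j)"
      have "F j (n - j) = (4 ^ j * U * V) *
         ((- 1) ^ j / fact (n - j)) * w j * \<rho> ^ n"
        unfolding F_def u_def e1 e2 U_def[symmetric] V_def[symmetric] by simp
      also have "4 ^ j * U * V = pochhammer (s - 1) n * pochhammer (of_nat n + a + b + c + d - 1) j"
        unfolding U_def V_def by (rule P)
      also have "(- 1) ^ j / fact (n - j) = pochhammer (- of_nat n) j / (fact n :: complex)"
        by (rule pochhammer_minus_of_nat[OF j, symmetric])
      finally show ?thesis
        by simp
    qed
    show ?thesis
      unfolding wilson_hyp_def w_def[symmetric] sum_distrib_left sum_distrib_right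
      by (intro sum.cong refl t) simp
  qed
  with S(2) show ?thesis
    unfolding Seq z_def[symmetric] hyp by simp
qed

text \<open>The local expansion and the identity theorem show that \<open>f\<close> agrees with the
  \<open>4F3\<close> series on the unit disk. As \<open>f\<close> is holomorphic on the whole slit
  plane, it is the continuation, and its definition can be solved for the power series.\<close>

lemma wilson_generating_function:
  fixes a b c d x \<rho> :: complex
  defines "s \<equiv> a + b + c + d"
  assumes pos: "Re a > 0" "Re b > 0" "Re c > 0" "Re d > 0" and \<rho>: "norm \<rho> < 1"
  shows "(\<lambda>n. pochhammer (s - 1) n / fact n * wilson_hyp x a b c d n * \<rho> ^ n) sums
     ((1 - \<rho>) powr (1 - s) * hyp_continued [(s - 1) / 2, s / 2, a + \<i> * x, a - \<i> * x]
        [a + b, a + c, a + d] (- 4 * \<rho> / (1 - \<rho>)\<^sup>2))"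
proof -
  define G where "G n = pochhammer (s - 1) n / fact n * wilson_hyp x a b c d n" for n
  define g where "g = (\<lambda>\<rho>. \<Sum>n. G n * \<rho> ^ n)"
  define H where "H = hyp_series [(s - 1) / 2, s / 2, a + \<i> * x, a - \<i> * x] [a + b, a + c, a + d]"
  define f where "f z = (1 - slit_to_disk z) powr (s - 1) * g (slit_to_disk z)" for z
  have G: "subexp G"
    unfolding G_def by (intro subexp_mult subexp_pochhammer_fact subexp_wilson_hyp pos)
  have "g \<circ> slit_to_disk holomorphic_on slit_plane"
  proof (rule holomorphic_on_compose_gen[OF slit_to_disk_holomorphic])
    show "g holomorphic_on ball 0 1"
      unfolding g_def by (rule subexp_holomorphic[OF G])
    show "slit_to_disk ` slit_plane \<subseteq> ball 0 1"
      using slit_to_disk(1) by auto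
  qed
  \<comment> \<open>Keeps the base off the branch cut, so that the principal power in
    \<open>f\<close> is holomorphic.\<close>
  moreover have "1 - slit_to_disk z \<notin> \<real>\<^sub>\<le>\<^sub>0" if "z \<in> slit_plane" for z
  proof -
    have "Re (slit_to_disk z) < 1"
      using slit_to_disk(1)[OF that] complex_Re_le_cmod le_less_trans by blast
    then show ?thesis
      by (auto simp: complex_nonpos_Reals_iff)
  qed
  ultimately have fh: "f holomorphic_on slit_plane"
    unfolding f_def o_def by (intro holomorphic_intros slit_to_disk_holomorphic) auto
  have powr_cancel: "(1 - w) powr (s - 1) * (1 - w) powr (1 - s) = 1" if "norm w < 1" for w :: complex
  proof -
    have "1 - w \<noteq> 0" using that by auto
    then show ?thesis
      by (simp flip: powr_add)
  qed
  have "continuous (at 0) slit_to_disk"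
  proof -
    have "0 \<in> slit_plane"
      using ball_subset_slit_plane by auto
    then show ?thesis
      using holomorphic_on_imp_continuous_on[OF slit_to_disk_holomorphic]
      by (simp add: continuous_on_eq_continuous_at open_slit_plane)
  qed
  moreover have "slit_to_disk 0 = 0"
    by (simp add: slit_to_disk_def)
  \<comment> \<open>Continuity at 0 carries a neighbourhood of \<open>z = 0\<close> into the small
    disk where the local expansion is valid.\<close>
  ultimately obtain \<delta> where \<delta>: "\<delta> > 0" "\<And>z. norm z < \<delta> \<Longrightarrow> norm (slit_to_disk z) < 1 / 10"
    unfolding continuous_at_eps_delta by (metis dist_0_norm dist_commute zero_less_divide_1_iff zero_less_numeral)
  have near0: "f z = H z" if "z \<in> ball 0 (min \<delta> 1)" for z
  proof -
    define w where "w = slit_to_disk z"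
    have "z \<in> slit_plane"
      using that ball_subset_slit_plane by auto
    then have w: "- 4 * w / (1 - w)\<^sup>2 = z" "norm w < 1"
      using slit_to_disk by (simp_all add: w_def)
    have "norm w < 1 / 10"
      unfolding w_def by (rule \<delta>(2)) (use that in simp)
    from wilson_generating_function_near_0[OF this, of a b c d x]
    have "g w = (1 - w) powr (1 - s) * H z"
      unfolding g_def G_def H_def s_def[symmetric] w(1) by (simp add: sums_iff)
    then show ?thesis
      unfolding f_def w_def[symmetric] using powr_cancel[OF w(2)] by simp
  qed
  have f_eq: "f u = H u" if "u \<in> ball 0 1" for u
  proof (rule analytic_continuation_open[where s = "ball 0 (min \<delta> 1)" and s' = "ball 0 1" and f = f and g = H])
    show "f holomorphic_on ball 0 1"
      using fh ball_subset_slit_plane holomorphic_on_subset by blast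
    show "H holomorphic_on ball 0 1"
      unfolding H_def by (rule hyp_series_4F3_holomorphic)
  qed (use that \<delta> near0 in auto)
  define z where "z = - 4 * \<rho> / (1 - \<rho>)\<^sup>2"
  have z: "z \<in> slit_plane" "slit_to_disk z = \<rho>"
    using disk_to_slit[OF \<rho>] by (simp_all add: z_def)
  have "hyp_continued [(s - 1) / 2, s / 2, a + \<i> * x, a - \<i> * x] [a + b, a + c, a + d] z = f z"
    by (rule hyp_continued_eqI[OF fh _ z(1)]) (use f_eq in \<open>simp add: H_def\<close>)
  also have "\<dots> = (1 - \<rho>) powr (s - 1) * g \<rho>"
    by (simp add: f_def z)
  finally have "(1 - \<rho>) powr (1 - s) * hyp_continued [(s - 1) / 2, s / 2, a + \<i> * x, a - \<i> * x]
        [a + b, a + c, a + d] z = g \<rho>"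
    using powr_cancel[OF \<rho>] by (simp add: mult_ac)
  moreover have "(\<lambda>n. G n * \<rho> ^ n) sums g \<rho>"
    unfolding g_def by (intro summable_sums subexp_summable_complex G \<rho>)
  ultimately show ?thesis
    by (simp add: G_def z_def)
qed

section \<open>Absolute convergence and rearrangement of the right-hand side\<close>

theorem theorem2p2:
  fixes \<rho> a b c d h :: complex and x :: real
  assumes "norm \<rho> < 1"
    and "x > 0"
    and "Re a > 0" and "Re b > 0" and "Re c > 0" and "Re d > 0" and "Re h > 0"
    and "nonreal_in_conjugate_pairs {#a, b, c, d#}"
    and "nonreal_in_conjugate_pairs {#a, b, c, h#}"
  shows
    "(\<lambda>k. (pochhammer (of_nat k + a + b + c + d - 1) k * pochhammer (a + b + c + d - 1) k) /
            (pochhammer (of_nat k + a + b + c + h - 1) k *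
             pochhammer (a + b) k * pochhammer (a + c) k * pochhammer (a + d) k * fact k) *
          hyp_series
            [2 * of_nat k + a + b + c + d - 1, d - h, of_nat k + b + c]
            [2 * of_nat k + a + b + c + h, a + d + of_nat k] \<rho> *
          \<rho> ^ k * wilson k (of_real x) a b c h)
     sums
       ((1 - \<rho>) powr (1 - a - b - c - d) *
        hyp_continued
          [(a + b + c + d - 1) / 2, (a + b + c + d) / 2, a + \<i> * of_real x, a - \<i> * of_real x]
          [a + b, a + c, a + d]
          (- 4 * \<rho> / (1 - \<rho>)\<^sup>2))"
proof -
  define s where "s = a + b + c + d"
  define \<sigma> where "\<sigma> = a + b + c + h - 1"
  define r where "r = norm \<rho>"
  define p where "p = wilson_hyp x a b c h"
  \<comment> \<open>The prefactor of the Wilson polynomial is already included: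
    \<open>(a + b)\<^sub>k\<close> and \<open>(a + c)\<^sub>k\<close> have cancelled, and
    \<open>(a + h)\<^sub>k\<close> has joined the numerator.\<close>
  define K where "K k = pochhammer (of_nat k + s - 1) k * pochhammer (s - 1) k * pochhammer (a + h) k /
          (pochhammer (of_nat k + \<sigma>) k * pochhammer (a + d) k * fact k)" for k
  define T where "T k m = pochhammer (2 * of_nat k + s - 1) m * pochhammer (d - h) m * pochhammer (of_nat k + b + c) m /
          (pochhammer (2 * of_nat k + \<sigma> + 1) m * pochhammer (a + d + of_nat k) m * fact m)" for k m
  define F where "F k m = K k * p k * \<rho> ^ k * (T k m * \<rho> ^ m)" for k m
  note pos = assms(3-7)
  have r: "0 \<le> r" "r < 1" using assms(1) by (simp_all add: r_def)
  have pnz: "pochhammer w m \<noteq> 0" if "Re w > 0" for w :: complex and m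
    using that by (rule pochhammer_nz)

  \<comment> \<open>A lower bound for the real part of \<open>k + \<sigma>\<close> when
    \<open>k > 0\<close>, and of \<open>2k + \<sigma> + 1\<close> for every
    \<open>k\<close>.\<close>
  define \<delta> where "\<delta> = Re (\<sigma> + 1)"
  have \<delta>: "\<delta> > 0" using pos by (simp add: \<delta>_def \<sigma>_def)
  \<comment> \<open>Here the bases move with \<open>k\<close>, so
    \<open>subexp_pochhammer_ratio\<close> does not apply directly. As they differ by the constant
    \<open>d - h\<close>, the quotient is compared with one of fixed base \<open>\<delta>\<close>;
    for \<open>k = 0\<close> both are 1.\<close>
  define R where "R k = pochhammer (of_nat k + \<sigma> + (d - h)) k / pochhammer (of_nat k + \<sigma>) k" for k
  have "subexp R"
  proof (rule subexp_mono[OF subexp_pochhammer_ratio])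
    fix k
    have "norm (R k) \<le> pochhammer (\<delta> + norm (d - h)) k / pochhammer \<delta> k"
    proof (cases "k = 0")
      case False
      then show ?thesis
        unfolding R_def using \<delta> by (intro norm_pochhammer_ratio_le) (simp_all add: \<delta>_def)
    qed (simp add: R_def)
    also have "\<dots> \<le> norm (pochhammer (\<delta> + norm (d - h)) k / pochhammer \<delta> k)"
      unfolding real_norm_def by (rule abs_ge_self)
    finally show "norm (R k) \<le> norm (pochhammer (\<delta> + norm (d - h)) k / pochhammer \<delta> k)" .
  qed
  then have "subexp (\<lambda>k. R k * (pochhammer (s - 1) k / fact k) * (pochhammer (a + h) k / pochhammer (a + d) k))"
    by (intro subexp_mult subexp_pochhammer_ratio subexp_pochhammer_fact)
  then have K: "subexp K"
  proof (rule subexp_mono)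
    fix k
    have e: "of_nat k + \<sigma> + (d - h) = of_nat k + s - 1"
      by (simp add: \<sigma>_def s_def)
    show "norm (K k) \<le> norm (R k * (pochhammer (s - 1) k / fact k) * (pochhammer (a + h) k / pochhammer (a + d) k))"
      unfolding K_def R_def e by (simp add: norm_mult norm_divide mult_ac)
  qed
  have "subexp p"
    unfolding p_def by (intro subexp_wilson_hyp pos)
  with K have Kp: "subexp (\<lambda>k. K k * p k)"
    by (rule subexp_mult)

  \<comment> \<open>A bound for the \<open>3F2\<close> coefficients that is independent of
    \<open>k\<close>. It exists because upper and lower parameters move with \<open>k\<close> at the
    same speed, and it gives the double series a product majorant.\<close>
  define \<beta> where "\<beta> m = (pochhammer (\<delta> + norm (d - h - 1)) m / pochhammer \<delta> m) *
      (pochhammer (Re (a + d) + norm (b + c - a - d)) m / pochhammer (Re (a + d)) m) *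
      norm (pochhammer (d - h) m / fact m)" for m
  have "subexp \<beta>"
    unfolding \<beta>_def by (intro subexp_mult subexp_norm subexp_pochhammer_ratio subexp_pochhammer_fact)
  moreover have \<beta>0: "\<beta> m \<ge> 0" for m
    unfolding \<beta>_def using \<delta> pos
    by (intro mult_nonneg_nonneg divide_nonneg_nonneg pochhammer_nonneg add_pos_nonneg norm_ge_zero) simp_all
  ultimately have \<beta>: "summable (\<lambda>m. \<beta> m * r ^ m)"
    using subexp_summable[of \<beta> r] r by simp
  have T: "norm (T k m) \<le> \<beta> m" for k m
  proof -
    have e: "2 * of_nat k + s - 1 = 2 * of_nat k + \<sigma> + 1 + (d - h - 1)"
      "of_nat k + b + c = a + d + of_nat k + (b + c - a - d)"
      by (simp_all add: s_def \<sigma>_def)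
    have "norm (T k m) = norm (pochhammer (2 * of_nat k + s - 1) m / pochhammer (2 * of_nat k + \<sigma> + 1) m) *
        norm (pochhammer (of_nat k + b + c) m / pochhammer (a + d + of_nat k) m) * norm (pochhammer (d - h) m / fact m)"
      by (simp add: T_def norm_mult norm_divide)
    also have "\<dots> \<le> \<beta> m"
      unfolding e \<beta>_def using \<delta> pos
      by (intro mult_right_mono mult_mono norm_pochhammer_ratio_le norm_ge_zero divide_nonneg_nonneg
          pochhammer_nonneg add_pos_nonneg) (simp_all add: \<delta>_def)
    finally show ?thesis .
  qed

  have F_le: "norm (F k m) \<le> norm (K k * p k) * r ^ k * (\<beta> m * r ^ m)" for k m
  proof -
    have "norm (F k m) = norm (K k * p k) * r ^ k * (norm (T k m) * r ^ m)"
      by (simp add: F_def norm_mult norm_power r_def)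
    also have "\<dots> \<le> norm (K k * p k) * r ^ k * (\<beta> m * r ^ m)"
      using r by (intro mult_left_mono mult_right_mono T) auto
    finally show ?thesis .
  qed
  have rows: "summable (\<lambda>m. norm (F k m))" for k
    by (rule summable_comparison_test'[OF summable_mult[OF \<beta>]]) (use F_le in simp)
  have rows_le: "(\<Sum>m. norm (F k m)) \<le> norm (K k * p k) * r ^ k * (\<Sum>m. \<beta> m * r ^ m)" for k
    using suminf_le[OF F_le rows summable_mult[OF \<beta>]] suminf_mult[OF \<beta>] by simp
  have cols: "summable (\<lambda>k. norm (K k * p k) * r ^ k * (\<Sum>m. \<beta> m * r ^ m))"
    by (intro summable_mult2 subexp_summable Kp r)
  obtain S where S: "(\<lambda>k. \<Sum>m. F k m) sums S" "(\<lambda>n. \<Sum>k\<le>n. F k (n - k)) sums S"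
    by (rule sums_triangle[OF rows rows_le cols])

  \<comment> \<open>The coefficient of \<open>\<rho> ^ n\<close> in the double series is the
    connection formula, so the diagonal sums form the generating function of the left-hand
    side.\<close>
  have diag: "(\<Sum>k\<le>n. F k (n - k)) = pochhammer (s - 1) n / fact n * wilson_hyp x a b c d n * \<rho> ^ n" for n
  proof -
    have "F k (n - k) = K k * T k (n - k) * p k * \<rho> ^ n" if "k \<le> n" for k
    proof -
      have "\<rho> ^ n = \<rho> ^ k * \<rho> ^ (n - k)"
        using that by (simp flip: power_add)
      then show ?thesis
        by (simp add: F_def)
    qed
    then have "(\<Sum>k\<le>n. F k (n - k)) = (\<Sum>k\<le>n. K k * T k (n - k) * p k) * \<rho> ^ n"
      unfolding sum_distrib_right by (intro sum.cong) simp_all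
    also have "(\<Sum>k\<le>n. K k * T k (n - k) * p k) = pochhammer (s - 1) n / fact n * wilson_hyp x a b c d n"
      unfolding K_def T_def p_def s_def \<sigma>_def using wilson_hyp_connection[OF pos] by simp
    finally show ?thesis .
  qed
  have "(\<lambda>n. \<Sum>k\<le>n. F k (n - k)) sums
     ((1 - \<rho>) powr (1 - s) * hyp_continued [(s - 1) / 2, s / 2, a + \<i> * x, a - \<i> * x]
        [a + b, a + c, a + d] (- 4 * \<rho> / (1 - \<rho>)\<^sup>2))"
    unfolding diag s_def by (rule wilson_generating_function) (use pos assms in auto)
  with S(2) have Seq: "S = (1 - \<rho>) powr (1 - s) * hyp_continued [(s - 1) / 2, s / 2, a + \<i> * x, a - \<i> * x]
        [a + b, a + c, a + d] (- 4 * \<rho> / (1 - \<rho>)\<^sup>2)"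
    by (rule sums_unique2)
  have row: "(\<Sum>m. F k m) = (pochhammer (of_nat k + a + b + c + d - 1) k * pochhammer (a + b + c + d - 1) k) /
            (pochhammer (of_nat k + a + b + c + h - 1) k *
             pochhammer (a + b) k * pochhammer (a + c) k * pochhammer (a + d) k * fact k) *
          hyp_series
            [2 * of_nat k + a + b + c + d - 1, d - h, of_nat k + b + c]
            [2 * of_nat k + a + b + c + h, a + d + of_nat k] \<rho> *
          \<rho> ^ k * wilson k (of_real x) a b c h" for k
  proof -
    have e: "of_nat k + a + b + c + d - 1 = of_nat k + s - 1" "a + b + c + d - 1 = s - 1"
      "of_nat k + a + b + c + h - 1 = of_nat k + \<sigma>"
      "2 * of_nat k + a + b + c + d - 1 = 2 * of_nat k + s - 1"
      "2 * of_nat k + a + b + c + h = 2 * of_nat k + \<sigma> + 1"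
      by (simp_all add: s_def \<sigma>_def)
    have "hyp_series [2 * of_nat k + s - 1, d - h, of_nat k + b + c] [2 * of_nat k + \<sigma> + 1, a + d + of_nat k] \<rho>
       = (\<Sum>m. T k m * \<rho> ^ m)"
      unfolding hyp_series_def T_def by (simp add: mult_ac)
    moreover have "summable (\<lambda>m. T k m * \<rho> ^ m)"
    proof (rule summable_comparison_test'[OF \<beta>])
      show "norm (T k m * \<rho> ^ m) \<le> \<beta> m * r ^ m" for m
        using mult_right_mono[OF T, of "r ^ m"] r by (simp add: norm_mult norm_power r_def)
    qed
    then have "(\<Sum>m. F k m) = K k * p k * \<rho> ^ k * (\<Sum>m. T k m * \<rho> ^ m)"
      unfolding F_def by (rule suminf_mult)
    ultimately show ?thesis
      unfolding e wilson_eq K_def p_def using pnz[of "a + b" k] pnz[of "a + c" k] pos by (simp add: mult_ac)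
  qed
  have e: "1 - s = 1 - a - b - c - d"
    by (simp add: s_def)
  show ?thesis
    using S(1) unfolding row Seq e unfolding s_def .
qed

end
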